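(* Let $d\ge1$, $x_0\in\mathbb{R}^d$, let $F,G:\mathbb{R}^d\times\mathbb{R}^d\to\mathbb{R}^d$ be globally Lipschitz, and let $\lambda=0$. Let $U:(0,\infty)\times\mathbb{R}^d\to\mathbb{R}^d$ be a solution of the planning problem master equation, that is, a solution of $$\partial_tU+(F(x,U)\cdot\nabla_x)U=G(x,U)\ \text{ in }(0,\infty)\times\mathbb{R}^d$$ such that $U(t,\cdot)$ converges to $A_{x_0}$ in the sense of graphs as $t\to0$. Then for any $x_1\in\mathbb{R}^d$ and $t_1>0$, the trajectory $(x(t))_{0<t\le t_1}$ defined (backward) by $$\frac{d}{dt}x(t)=F\big(x(t),U(t,x(t))\big)\ \ (0<t\le t_1),\qquad x(t_1)=x_1,$$ is such that $x(t)\to x_0$ as $t\to0$.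
   Context: $(F(x,U)\cdot\nabla_x)U$ has $i$-th component $\sum_jF_j(x,U(t,x))\,\partial_{x_j}U^i(t,x)$. $A_{x_0}$ is the multivalued operator on $\mathbb{R}^d$ with domain $\{x_0\}$ and $A_{x_0}(x_0)=\mathbb{R}^d$. A sequence of multivalued operators $(A_n)$ converges to $A$ in the sense of graphs if, whenever $y_n\in A_n(x_n)$ for all $n$ and $(x_n,y_n)\to(x,y)$, one has $y\in A(x)$. Thus $U(t,\cdot)\to A_{x_0}$ in the sense of graphs as $t\to0$ means: for all sequences $t_n\to0^+$, $x_n\to x$ with $U(t_n,x_n)$ convergent, one has $x=x_0$. Being a solution of the equation means being locally Lipschitz on $(0,\infty)\times\mathbb{R}^d$ and satisfying it almost everywhere. *)

theory Defs
  imports "HOL-Analysis.Analysis"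
begin

definition globally_lipschitz ::
    "('a::metric_space \<Rightarrow> 'b::metric_space \<Rightarrow> 'c::metric_space) \<Rightarrow> bool" where
  "globally_lipschitz F \<longleftrightarrow> (\<exists>L. L-lipschitz_on UNIV (\<lambda>(x, u). F x u))"

text \<open>Joint local Lipschitz continuity; the library's \<open>local_lipschitz\<close> is not used because it
  only asks for Lipschitz continuity in the second argument.\<close>
definition locally_lipschitz_on ::
    "'a::metric_space set \<Rightarrow> ('a \<Rightarrow> 'b::metric_space) \<Rightarrow> bool" where
  "locally_lipschitz_on S f \<longleftrightarrow>
     (\<forall>p\<in>S. \<exists>r>0. \<exists>L. L-lipschitz_on (ball p r \<inter> S) f)"

text \<open>A multivalued operator is a set-valued function; its domain is the set of points with
  nonempty value.\<close>
definition point_operator :: "'a \<Rightarrow> 'a \<Rightarrow> 'b set" where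
  "point_operator x0 x = (if x = x0 then UNIV else {})"

definition graph_converges ::
    "(nat \<Rightarrow> 'a::topological_space \<Rightarrow> 'b::topological_space set) \<Rightarrow> ('a \<Rightarrow> 'b set) \<Rightarrow> bool" where
  "graph_converges A\<^sub>n A \<longleftrightarrow>
     (\<forall>\<xi> \<eta> x y. (\<forall>n. \<eta> n \<in> A\<^sub>n n (\<xi> n)) \<longrightarrow> \<xi> \<longlonglongrightarrow> x \<longrightarrow> \<eta> \<longlonglongrightarrow> y \<longrightarrow> y \<in> A x)"

definition graph_converges_at_0 ::
    "(real \<Rightarrow> 'a::topological_space \<Rightarrow> 'b::topological_space) \<Rightarrow> ('a \<Rightarrow> 'b set) \<Rightarrow> bool" where
  "graph_converges_at_0 U A \<longleftrightarrow>
     (\<forall>\<tau>. (\<forall>n. \<tau> n > 0) \<longrightarrow> \<tau> \<longlonglongrightarrow> 0 \<longrightarrow> graph_converges (\<lambda>n x. {U (\<tau> n) x}) A)"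

text \<open>The equation \<open>\<partial>\<^sub>t U + (F(x,U) \<cdot> \<nabla>\<^sub>x) U = G(x,U)\<close> at the point \<open>(t,x)\<close>, including existence of
  the partial derivatives: \<open>Ut\<close> is \<open>\<partial>\<^sub>t U\<close> and \<open>DU i j\<close> is the derivative of the \<open>i\<close>-th component
  of \<open>U\<close> in the direction of \<open>x\<^sub>j\<close>.\<close>
definition master_equation_at ::
    "(real^'n \<Rightarrow> real^'n \<Rightarrow> real^'n) \<Rightarrow> (real^'n \<Rightarrow> real^'n \<Rightarrow> real^'n) \<Rightarrow>
     (real \<Rightarrow> real^'n \<Rightarrow> real^'n) \<Rightarrow> real \<Rightarrow> real^'n \<Rightarrow> bool" where
  "master_equation_at F G U t x \<longleftrightarrow>
     (\<exists>Ut DU.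
        ((\<lambda>s. U s x) has_vector_derivative Ut) (at t) \<and>
        (\<forall>i j. ((\<lambda>s. U t (x + s *\<^sub>R axis j 1) $ i) has_real_derivative DU i j) (at 0)) \<and>
        (\<forall>i. Ut $ i + (\<Sum>j\<in>UNIV. F x (U t x) $ j * DU i j) = G x (U t x) $ i))"

definition master_equation_solution ::
    "(real^'n \<Rightarrow> real^'n \<Rightarrow> real^'n) \<Rightarrow> (real^'n \<Rightarrow> real^'n \<Rightarrow> real^'n) \<Rightarrow>
     (real \<Rightarrow> real^'n \<Rightarrow> real^'n) \<Rightarrow> bool" where
  "master_equation_solution F G U \<longleftrightarrow>
     locally_lipschitz_on ({0<..} \<times> UNIV) (\<lambda>(t, x). U t x) \<and>
     (AE (t, x) in lebesgue. t > 0 \<longrightarrow> master_equation_at F G U t x)"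

definition planning_solution ::
    "(real^'n \<Rightarrow> real^'n \<Rightarrow> real^'n) \<Rightarrow> (real^'n \<Rightarrow> real^'n \<Rightarrow> real^'n) \<Rightarrow> real^'n \<Rightarrow>
     (real \<Rightarrow> real^'n \<Rightarrow> real^'n) \<Rightarrow> bool" where
  "planning_solution F G x0 U \<longleftrightarrow>
     master_equation_solution F G U \<and> graph_converges_at_0 U (point_operator x0)"

text \<open>Only the values of \<open>x\<close> on \<open>(0, t1]\<close> matter; the derivative at \<open>t1\<close> is one-sided.\<close>
definition backward_trajectory ::
    "(real^'n \<Rightarrow> real^'n \<Rightarrow> real^'n) \<Rightarrow> (real \<Rightarrow> real^'n \<Rightarrow> real^'n) \<Rightarrow> real \<Rightarrow> real^'n \<Rightarrow>
     (real \<Rightarrow> real^'n) \<Rightarrow> bool" where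
  "backward_trajectory F U t1 x1 x \<longleftrightarrow>
     (\<forall>t\<in>{0<..t1}. (x has_vector_derivative F (x t) (U t (x t))) (at t within {0<..t1})) \<and>
     x t1 = x1"

end

theory Submission
  imports Defs
begin

text \<open>
  The proof follows characteristics. Along a trajectory \<open>x' = F(x, U(t, x))\<close> the value
  \<open>u(t) = U(t, x(t))\<close> should satisfy \<open>u' = G(x, u)\<close>, so that \<open>(x, u)\<close> solves the system
  \<open>X' = F(X, W)\<close>, \<open>W' = G(X, W)\<close>. This system is globally Lipschitz and no longer mentions \<open>U\<close>,
  hence its solution with data \<open>X(t1) = x1\<close>, \<open>W(t1) = U(t1, x1)\<close> exists on all of \<open>[0, t1]\<close>
  (\<open>characteristic_system_backward_solution\<close>). If \<open>W(t) = U(t, X(t))\<close> for \<open>0 < t \<le> t1\<close>, then \<open>X\<close> is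
  the trajectory through \<open>x1\<close>. As \<open>t \<rightarrow> 0\<close>, the points \<open>(X(t), U(t, X(t)))\<close> of the graphs
  of \<open>U(t, \<cdot>)\<close> converge to \<open>(X(0), W(0))\<close>, and graph convergence forces \<open>X(0) = x0\<close>: the value of
  \<open>U\<close> stays bounded along the trajectory, whereas in the limit every finite value sits over \<open>x0\<close>.

  The difficulty is the identity \<open>W(t) = U(t, X(t))\<close> (\<open>characteristics_carry_solution\<close>). The master
  equation holds only almost everywhere, and a single curve is a null set. Each component \<open>g\<close> of \<open>U\<close>
  is therefore mollified. Near the curve, the mollification \<open>g * \<rho>\<close> satisfies the equation at every
  point up to an error of the order of the radius of \<open>\<rho>\<close>, since \<open>F(x, U)\<close> and \<open>G(x, U)\<close> are
  locally Lipschitz in \<open>(t, x)\<close> and \<open>\<nabla>g\<close> is bounded. Bounding the increments of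
  \<open>g * \<rho>\<close> along the curve and letting the radius tend to 0 yields those of \<open>g\<close> (\<open>transport_along_curve\<close>). Because only
  partial derivatives of \<open>g\<close> are given, the chain rule for \<open>g * \<rho>\<close> is obtained from an estimate of
  its second differences (\<open>mollify_second_difference\<close>) instead of from differentiability of \<open>g\<close>.

  For an arbitrary curve the resulting estimate contains the deviation of its velocity from
  the characteristic velocity. For \<open>(t, X(t))\<close> this deviation is at most a constant times
  \<open>\<bar>W(t) - U(t, X(t))\<bar>\<close>, and a Gronwall argument, which starts from the equality at \<open>t1\<close>, closes
  the proof (\<open>zero_by_local_increment_bound\<close>). The same Gronwall argument gives uniqueness
  of the trajectory.
\<close>

section \<open>Global solutions of Lipschitz differential equations\<close>

text \<open>Picard iteration on the whole interval \<open>[0, T]\<close> at once: measured in the norm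
  \<open>sup \<bar>exp (- \<lambda> s) Y s\<bar>\<close>, the integral operator contracts by \<open>K / \<lambda>\<close>, which is below 1 for
  \<open>\<lambda> = K + 1\<close> whatever the length of the interval.\<close>
lemma lipschitz_ode_solution_exists:
  fixes \<Phi> :: "'a::euclidean_space \<Rightarrow> 'a"
  assumes lip: "K-lipschitz_on UNIV \<Phi>" and T: "0 \<le> T"
  obtains Y where "Y 0 = z"
    and "\<And>s. s \<in> {0..T} \<Longrightarrow> (Y has_vector_derivative \<Phi> (Y s)) (at s within {0..T})"
proof -
  define lam where "lam = K + 1"
  have K0: "0 \<le> K" by (rule lipschitz_on_nonneg[OF lip])
  hence lam: "0 < lam" by (simp add: lam_def)
  have cont\<Phi>: "continuous_on UNIV \<Phi>" by (rule lipschitz_on_continuous_on[OF lip])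
  \<comment> \<open>The Banach space at hand consists of functions on the whole line, so a function on
  \<open>[0, T]\<close> is represented by its constant extension on both sides.\<close>
  define clamp where "clamp s = min T (max 0 s)" for s :: real
  have clamp: "clamp s \<in> {0..T}" "0 \<le> clamp s" "clamp s \<le> T" for s using T by (auto simp: clamp_def)
  have clamp_id: "clamp s = s" if "s \<in> {0..T}" for s using that by (auto simp: clamp_def)
  have contclamp: "continuous_on UNIV clamp"
    unfolding clamp_def by (intro continuous_intros)
  \<comment> \<open>The unknown is the weighted function \<open>\<psi> s = exp (- \<lambda> s) Y s\<close>, so that the plain
  sup norm of \<open>\<psi>\<close> is the weighted norm of \<open>Y\<close>.\<close>
  define f where "f \<psi> r = \<Phi> (exp (lam * r) *\<^sub>R apply_bcontfun \<psi> r)"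
    for \<psi> :: "real \<Rightarrow>\<^sub>C 'a" and r
  define I where "I \<psi> u = z + integral {0..u} (f \<psi>)" for \<psi> u
  have contf: "continuous_on S (f \<psi>)" for \<psi> S
    unfolding f_def
    by (intro continuous_on_compose2[OF cont\<Phi>] continuous_intros) auto
  have derI: "(I \<psi> has_vector_derivative f \<psi> u) (at u within {0..T})" if "u \<in> {0..T}" for \<psi> u
    unfolding I_def using integral_has_vector_derivative[OF contf that]
    by (auto intro!: derivative_eq_intros)
  have contI: "continuous_on {0..T} (I \<psi>)" for \<psi>
    by (rule continuous_on_vector_derivative) (rule derI)
  define h where "h \<psi> s = exp (- lam * clamp s) *\<^sub>R I \<psi> (clamp s)" for \<psi> s
  have conth: "continuous_on UNIV (h \<psi>)" for \<psi>
    unfolding h_def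
    by (intro continuous_intros contclamp continuous_on_compose2[OF contI contclamp])
       (use clamp in auto)
  have "h \<psi> \<in> bcontfun" for \<psi>
  proof -
    have "bounded (h \<psi> ` {0..T})"
      by (intro compact_imp_bounded compact_continuous_image continuous_on_subset[OF conth]) auto
    then obtain B where B: "\<And>s. s \<in> {0..T} \<Longrightarrow> norm (h \<psi> s) \<le> B"
      unfolding bounded_iff by blast
    have "h \<psi> s = h \<psi> (clamp s)" for s by (simp add: h_def clamp_id clamp)
    hence "norm (h \<psi> s) \<le> B" for s using B[OF clamp(1)] by metis
    thus ?thesis by (rule bcontfun_normI[OF conth])
  qed
  define H where "H \<psi> = Bcontfun (h \<psi>)" for \<psi>
  have H: "apply_bcontfun (H \<psi>) = h \<psi>" for \<psi>
    unfolding H_def using \<open>\<And>\<psi>. h \<psi> \<in> bcontfun\<close> by (simp add: Bcontfun_inverse)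
  have contr: "dist (H \<psi>) (H \<theta>) \<le> K / lam * dist \<psi> \<theta>" for \<psi> \<theta>
  proof (rule dist_bound)
    fix s
    let ?u = "clamp s" and ?d = "dist \<psi> \<theta>"
    have "norm (I \<psi> ?u - I \<theta> ?u) = norm (integral {0..?u} (\<lambda>r. f \<psi> r - f \<theta> r))"
      unfolding I_def by (subst Henstock_Kurzweil_Integration.integral_diff)
        (auto intro!: integrable_continuous_real contf)
    also have "\<dots> \<le> integral {0..?u} (\<lambda>r. K * ?d * exp (lam * r))"
    proof (rule integral_norm_bound_integral)
      show "(\<lambda>r. f \<psi> r - f \<theta> r) integrable_on {0..?u}"
        by (intro integrable_continuous_real continuous_intros contf)
      show "(\<lambda>r. K * ?d * exp (lam * r)) integrable_on {0..?u}"
        by (intro integrable_continuous_real continuous_intros)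
      fix r
      have "norm (f \<psi> r - f \<theta> r)
          \<le> K * dist (exp (lam * r) *\<^sub>R apply_bcontfun \<psi> r) (exp (lam * r) *\<^sub>R apply_bcontfun \<theta> r)"
        unfolding f_def dist_norm[symmetric] by (rule lipschitz_onD[OF lip]) auto
      also have "\<dots> \<le> K * (exp (lam * r) * ?d)"
        using K0 dist_bounded[of \<psi> r \<theta>]
        by (intro mult_left_mono) (auto simp: dist_norm scaleR_diff_right[symmetric])
      finally show "norm (f \<psi> r - f \<theta> r) \<le> K * ?d * exp (lam * r)" by (simp add: mult_ac)
    qed
    also have "\<dots> = K * ?d * exp (lam * ?u) / lam - K * ?d / lam"
    proof (rule integral_unique)
      have "((\<lambda>r. K * ?d * exp (lam * r)) has_integral
          (K * ?d * exp (lam * ?u) / lam - K * ?d * exp (lam * 0) / lam)) {0..?u}"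
        using lam clamp(2)
        by (intro fundamental_theorem_of_calculus)
           (auto intro!: derivative_eq_intros simp: has_real_derivative_iff_has_vector_derivative[symmetric])
      thus "((\<lambda>r. K * ?d * exp (lam * r)) has_integral
          (K * ?d * exp (lam * ?u) / lam - K * ?d / lam)) {0..?u}" by simp
    qed
    also have "\<dots> \<le> K * ?d * exp (lam * ?u) / lam" using K0 lam by simp
    finally have le: "norm (I \<psi> ?u - I \<theta> ?u) \<le> K * ?d * exp (lam * ?u) / lam" .
    have "dist (h \<psi> s) (h \<theta> s) = exp (- lam * ?u) * norm (I \<psi> ?u - I \<theta> ?u)"
      by (simp add: h_def dist_norm scaleR_diff_right[symmetric])
    also have "\<dots> \<le> exp (- lam * ?u) * (K * ?d * exp (lam * ?u) / lam)"
      by (intro mult_left_mono le) auto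
    also have "\<dots> = K / lam * ?d" by (simp add: exp_minus field_simps)
    finally show "dist (apply_bcontfun (H \<psi>) s) (apply_bcontfun (H \<theta>) s) \<le> K / lam * dist \<psi> \<theta>"
      by (simp add: H)
  qed
  have "\<exists>!\<psi>. H \<psi> = \<psi>"
    by (rule banach_fix_type[where c = "K / lam"]) (use K0 contr in \<open>auto simp: lam_def\<close>)
  then obtain \<psi> where fixpt: "H \<psi> = \<psi>" by blast
  have \<psi>: "exp (lam * s) *\<^sub>R apply_bcontfun \<psi> s = I \<psi> s" if "s \<in> {0..T}" for s
  proof -
    have "apply_bcontfun \<psi> s = exp (- lam * s) *\<^sub>R I \<psi> s"
      using H[of \<psi>] that by (simp add: fixpt h_def clamp_id)
    thus ?thesis by (simp add: exp_minus)
  qed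
  show thesis
  proof
    show "I \<psi> 0 = z" by (simp add: I_def)
    show "(I \<psi> has_vector_derivative \<Phi> (I \<psi> s)) (at s within {0..T})" if "s \<in> {0..T}" for s
      using derI[OF that, of \<psi>] by (simp add: f_def \<psi>[OF that])
  qed
qed

section \<open>A Gronwall argument by connectedness\<close>

text \<open>On an interval of length \<open>\<ell>\<close> next to a zero of \<open>\<delta>\<close>, the
  maximum \<open>M\<close> of \<open>\<bar>\<delta>\<bar>\<close> satisfies \<open>M \<le> C M \<ell>\<close>, hence \<open>M = 0\<close> for small \<open>\<ell>\<close>. So the zero set is open
  in \<open>S\<close>; it is closed as well, and \<open>S\<close> is connected. The constants may depend on the zero, which
  is what local Lipschitz assumptions provide.\<close>
lemma zero_by_local_increment_bound:
  fixes \<delta> :: "real \<Rightarrow> 'a::real_normed_vector"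
  assumes "connected S" and "t1 \<in> S" "\<delta> t1 = 0" and cont: "continuous_on S \<delta>"
    and local: "\<And>s. s \<in> S \<Longrightarrow> \<delta> s = 0 \<Longrightarrow> \<exists>d>0. \<exists>C. \<forall>a\<in>S. \<forall>b\<in>S. \<forall>M.
      a \<le> b \<longrightarrow> \<bar>a - s\<bar> < d \<longrightarrow> \<bar>b - s\<bar> < d \<longrightarrow> (\<forall>\<tau>\<in>{a..b}. norm (\<delta> \<tau>) \<le> M) \<longrightarrow>
      norm (\<delta> b - \<delta> a) \<le> C * M * (b - a)"
    and "t \<in> S"
  shows "\<delta> t = 0"
proof -
  have iv: "is_interval S" using \<open>connected S\<close> by (simp add: is_interval_connected_1)
  have "openin (top_of_set S) {s \<in> S. \<delta> s = 0}"
  proof (subst openin_euclidean_subtopology_iff, intro conjI ballI)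
    fix s assume "s \<in> {s \<in> S. \<delta> s = 0}"
    hence s: "s \<in> S" "\<delta> s = 0" by auto
    obtain d C where "d > 0" and dC: "\<And>a b M. \<lbrakk>a \<in> S; b \<in> S; a \<le> b; \<bar>a - s\<bar> < d; \<bar>b - s\<bar> < d;
        \<And>\<tau>. \<tau> \<in> {a..b} \<Longrightarrow> norm (\<delta> \<tau>) \<le> M\<rbrakk> \<Longrightarrow> norm (\<delta> b - \<delta> a) \<le> C * M * (b - a)"
      using local[OF s] by metis
    define d' where "d' = min d (1 / (2 * (\<bar>C\<bar> + 1)))"
    have d': "0 < d'" "d' \<le> d" "\<bar>C\<bar> * d' \<le> 1 / 2"
    proof -
      show "0 < d'" "d' \<le> d" using \<open>d > 0\<close> by (auto simp: d'_def add_nonneg_pos)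
      have "\<bar>C\<bar> * d' \<le> \<bar>C\<bar> * (1 / (2 * (\<bar>C\<bar> + 1)))" by (intro mult_left_mono) (auto simp: d'_def)
      also have "\<dots> \<le> 1 / 2" by (simp add: field_simps)
      finally show "\<bar>C\<bar> * d' \<le> 1 / 2" .
    qed
    have "\<delta> u = 0" if u: "u \<in> S" "\<bar>u - s\<bar> < d'" for u
    proof -
      let ?I = "{min s u..max s u}"
      have IS: "?I \<subseteq> S"
      proof
        fix x assume "x \<in> ?I"
        thus "x \<in> S"
          using mem_is_interval_1_I[OF iv s(1) u(1)] mem_is_interval_1_I[OF iv u(1) s(1)]
          by (cases "s \<le> u") auto
      qed
      have "continuous_on ?I (\<lambda>\<tau>. norm (\<delta> \<tau>))"
        by (intro continuous_intros continuous_on_subset[OF cont IS])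
      from continuous_attains_sup[OF _ _ this]
      have "\<exists>m\<in>?I. \<forall>\<tau>\<in>?I. norm (\<delta> \<tau>) \<le> norm (\<delta> m)" by simp
      then obtain m where m: "m \<in> ?I" and max: "\<And>\<tau>. \<tau> \<in> ?I \<Longrightarrow> norm (\<delta> \<tau>) \<le> norm (\<delta> m)"
        by blast
      have mS: "m \<in> S" using m IS by auto
      have ms: "\<bar>m - s\<bar> \<le> \<bar>u - s\<bar>" using m by (auto simp: min_def max_def split: if_splits)
      have sub: "{min s m..max s m} \<subseteq> ?I" using m by (auto simp: min_def max_def split: if_splits)
      have "norm (\<delta> (max s m) - \<delta> (min s m)) \<le> C * norm (\<delta> m) * (max s m - min s m)"
        by (rule dC) (use sub max s mS ms u(2) d'(2) \<open>d > 0\<close> in \<open>auto simp: min_def max_def\<close>)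
      hence "norm (\<delta> m) \<le> C * norm (\<delta> m) * \<bar>m - s\<bar>"
        using s(2) by (auto simp: min_def max_def split: if_splits)
      also have "\<dots> \<le> (\<bar>C\<bar> * d') * norm (\<delta> m)"
      proof -
        have "C * \<bar>m - s\<bar> \<le> \<bar>C\<bar> * d'" using ms u(2) by (intro mult_mono) auto
        from mult_right_mono[OF this, of "norm (\<delta> m)"] show ?thesis by (simp add: mult_ac)
      qed
      also have "\<dots> \<le> 1 / 2 * norm (\<delta> m)" by (intro mult_right_mono d') auto
      finally have "norm (\<delta> m) = 0" by simp
      with max[of u] show ?thesis by (simp add: min_def max_def)
    qed
    thus "\<exists>e>0. \<forall>x'\<in>S. dist x' s < e \<longrightarrow> x' \<in> {s \<in> S. \<delta> s = 0}"
      using d'(1) by (auto simp: dist_real_def)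
  qed auto
  moreover have "closedin (top_of_set S) {s \<in> S. \<delta> s = 0}"
    by (rule continuous_closedin_preimage_constant[OF cont])
  ultimately have "{s \<in> S. \<delta> s = 0} = {} \<or> {s \<in> S. \<delta> s = 0} = S"
    using \<open>connected S\<close> unfolding connected_clopen by blast
  thus ?thesis using assms(2,3) \<open>t \<in> S\<close> by auto
qed

section \<open>Linear transport equations in terms of partial derivatives\<close>

text \<open>Only the partial derivatives of \<open>g\<close> along the axes have to exist at \<open>x\<close>. Even for a Lipschitz
  function they do not give a chain rule there.\<close>
definition transport_equation_at ::
    "('a::euclidean_space \<Rightarrow> real) \<Rightarrow> ('a \<Rightarrow> 'a) \<Rightarrow> ('a \<Rightarrow> real) \<Rightarrow> 'a \<Rightarrow> bool" where
  "transport_equation_at g b c x \<longleftrightarrow>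
     (\<exists>D. (\<forall>e\<in>Basis. ((\<lambda>s. g (x + s *\<^sub>R e)) has_real_derivative D e) (at 0)) \<and>
          (\<Sum>e\<in>Basis. (b x \<bullet> e) * D e) = c x)"

text \<open>Partial derivatives at \<open>x\<close> see only values near \<open>x\<close>, so a locally Lipschitz solution may be
  replaced by a globally Lipschitz function that agrees with it near \<open>x\<close>.\<close>
lemma transport_equation_at_transfer:
  assumes "transport_equation_at g b c x" and "open S" "x \<in> S" and eq: "\<And>y. y \<in> S \<Longrightarrow> g y = g' y"
  shows "transport_equation_at g' b c x"
proof -
  have "((\<lambda>s. g' (x + s *\<^sub>R e)) has_real_derivative D) (at 0)"
    if "((\<lambda>s. g (x + s *\<^sub>R e)) has_real_derivative D) (at 0)" for e D
  proof (rule has_field_derivative_transform_within_open[OF that])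
    show "open ((\<lambda>s. x + s *\<^sub>R e) -` S)"
      by (intro open_vimage \<open>open S\<close> continuous_intros)
  qed (use \<open>x \<in> S\<close> eq in auto)
  thus ?thesis using assms(1) unfolding transport_equation_at_def by metis
qed

section \<open>Mollification of Lipschitz functions\<close>

lemma integrable_continuous_compact_support:
  fixes f :: "'a::euclidean_space \<Rightarrow> real"
  assumes "continuous_on UNIV f" and "\<And>q. R < norm q \<Longrightarrow> f q = 0"
  shows "integrable lborel f"
proof -
  have "integrable lborel (\<lambda>q. indicator (cball 0 R) q *\<^sub>R f q)"
    by (intro borel_integrable_compact continuous_on_subset[OF assms(1)]) auto
  also have "(\<lambda>q. indicator (cball 0 R) q *\<^sub>R f q) = f"
    using assms(2) by (force simp: indicator_def fun_eq_iff)
  finally show ?thesis .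
qed

text \<open>A Lipschitz kernel is smooth enough here, since only second differences of a mollified
  Lipschitz function are estimated: one difference falls on the kernel, the other on the function.\<close>
definition lipschitz_kernel :: "real \<Rightarrow> real \<Rightarrow> ('a::euclidean_space \<Rightarrow> real) \<Rightarrow> bool" where
  "lipschitz_kernel \<epsilon> B \<rho> \<longleftrightarrow> B-lipschitz_on UNIV \<rho> \<and> (\<forall>q. 0 \<le> \<rho> q) \<and>
     (\<forall>q. \<epsilon> \<le> norm q \<longrightarrow> \<rho> q = 0) \<and> (LINT q|lborel. \<rho> q) = 1"

lemma lipschitz_kernelD:
  assumes "lipschitz_kernel \<epsilon> B \<rho>"
  shows "B-lipschitz_on UNIV \<rho>" "\<And>q. 0 \<le> \<rho> q" "\<And>q. \<epsilon> \<le> norm q \<Longrightarrow> \<rho> q = 0"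
    "(LINT q|lborel. \<rho> q) = 1" "continuous_on S \<rho>"
  using assms lipschitz_on_continuous_on[of B UNIV \<rho>]
  by (auto simp: lipschitz_kernel_def intro: continuous_on_subset)

lemma lipschitz_kernel_exists:
  assumes "0 < \<epsilon>"
  obtains B and \<rho> :: "'a::euclidean_space \<Rightarrow> real" where "lipschitz_kernel \<epsilon> B \<rho>"
proof -
  define tent where "tent q = max 0 (\<epsilon> - norm q)" for q :: 'a
  have cont: "continuous_on UNIV tent"
    unfolding tent_def by (intro continuous_intros)
  have int: "integrable lborel tent"
    by (rule integrable_continuous_compact_support[OF cont, of \<epsilon>]) (auto simp: tent_def)
  define m where "m = (LINT q|lborel. tent q)"
  have "0 < \<epsilon> / 2 * measure lborel (ball (0::'a) (\<epsilon> / 2))"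
    using assms content_ball_pos[of "\<epsilon> / 2" "0 :: 'a"] by simp
  also have "\<dots> = (LINT q|lborel. \<epsilon> / 2 * indicator (ball (0::'a) (\<epsilon> / 2)) q)" by simp
  also have "\<dots> \<le> m" unfolding m_def
    using emeasure_lborel_ball_finite[of "0 :: 'a" "\<epsilon> / 2"]
    by (intro integral_mono int integrable_mult_right integrable_real_indicator)
       (auto simp: tent_def indicator_def top.not_eq_extremum max_def)
  finally have m: "0 < m" .
  show thesis
  proof
    show "lipschitz_kernel \<epsilon> (1 / m) (\<lambda>q. tent q / m)"
      unfolding lipschitz_kernel_def
    proof (intro conjI allI impI lipschitz_onI)
      fix x y :: 'a
      have "\<bar>tent x - tent y\<bar> \<le> norm (x - y)"
        using norm_triangle_ineq3[of x y] by (auto simp: tent_def)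
      thus "dist (tent x / m) (tent y / m) \<le> 1 / m * dist x y"
        using m by (simp add: dist_norm diff_divide_distrib[symmetric] divide_right_mono)
    qed (use m in \<open>auto simp: tent_def m_def[symmetric] int[unfolded tent_def] m_def[unfolded tent_def, symmetric]\<close>)
  qed
qed

definition mollify :: "('a::euclidean_space \<Rightarrow> real) \<Rightarrow> ('a \<Rightarrow> real) \<Rightarrow> 'a \<Rightarrow> real" where
  "mollify \<rho> g x = (LINT q|lborel. \<rho> q * g (x + q))"

text \<open>When the vectors \<open>y a\<close> are added one after the other, each new one changes the increment only by
  a second difference. For functions with quadratically small second differences this replaces
  total differentiability: it controls increments in all directions by those along the axes.\<close>
lemma increment_close_to_sum_of_increments:
  fixes m :: "'a::real_normed_vector \<Rightarrow> real"
  assumes "finite A" and C: "0 \<le> C"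
    and second: "\<And>x y. norm x \<le> \<delta> \<Longrightarrow>
      \<bar>m (P + x + y) - m (P + x) - (m (P + y) - m P)\<bar> \<le> C * norm x * norm y"
    and "(\<Sum>a\<in>A. norm (y a)) \<le> \<delta>"
  shows "\<bar>m (P + (\<Sum>a\<in>A. y a)) - m P - (\<Sum>a\<in>A. m (P + y a) - m P)\<bar> \<le> C * (\<Sum>a\<in>A. norm (y a))\<^sup>2"
  using assms(1,4)
proof (induction A)
  case (insert a A)
  let ?x = "\<Sum>a\<in>A. y a" and ?S = "\<Sum>a\<in>A. norm (y a)"
  have S: "?S \<le> \<delta>" "norm ?x \<le> ?S" "0 \<le> ?S"
    using insert by (auto intro: norm_sum sum_nonneg order_trans[rotated])
  have "\<bar>m (P + ?x + y a) - m (P + ?x) - (m (P + y a) - m P)\<bar> \<le> C * norm ?x * norm (y a)"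
    by (rule second) (use S in auto)
  also have "\<dots> \<le> C * ?S * norm (y a)" using S C by (intro mult_right_mono mult_left_mono) auto
  finally have "\<bar>m (P + ?x + y a) - m P - ((m (P + y a) - m P) + (\<Sum>a\<in>A. m (P + y a) - m P))\<bar>
      \<le> C * ?S * norm (y a) + C * ?S\<^sup>2"
    using insert.IH[OF S(1)] by linarith
  also have "\<dots> \<le> C * (norm (y a) + ?S)\<^sup>2"
    using C S(3) by (simp add: power2_eq_square algebra_simps)
  finally show ?case using insert.hyps by (simp add: add_ac)
qed simp

context
  fixes \<rho> :: "'a::euclidean_space \<Rightarrow> real" and \<epsilon> B :: real
  assumes kernel: "lipschitz_kernel \<epsilon> B \<rho>"
begin

lemma kernel_integrable:
  assumes "continuous_on UNIV k"
  shows "integrable lborel (\<lambda>q. \<rho> q * k q)"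
  by (rule integrable_continuous_compact_support[of _ \<epsilon>])
     (use assms lipschitz_kernelD[OF kernel] in \<open>auto intro!: continuous_intros\<close>)

lemma kernel_average_le:
  assumes "continuous_on UNIV k" and "\<And>q. norm q < \<epsilon> \<Longrightarrow> \<bar>k q\<bar> \<le> M"
  shows "\<bar>LINT q|lborel. \<rho> q * k q\<bar> \<le> M"
proof -
  note K = lipschitz_kernelD[OF kernel]
  have "\<bar>LINT q|lborel. \<rho> q * k q\<bar> \<le> (LINT q|lborel. \<bar>\<rho> q * k q\<bar>)"
    by (rule integral_abs_bound)
  also have "\<dots> \<le> (LINT q|lborel. \<rho> q * M)"
  proof (intro integral_mono integrable_abs kernel_integrable assms continuous_intros)
    fix q show "\<bar>\<rho> q * k q\<bar> \<le> \<rho> q * M"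
      using K(2,3)[of q] assms(2)[of q]
      by (cases "norm q < \<epsilon>") (auto simp: abs_mult intro: mult_left_mono)
  qed
  also have "\<dots> = M" using K(4) by simp
  finally show ?thesis .
qed

context
  fixes g :: "'a \<Rightarrow> real" and L :: real
  assumes lip: "L-lipschitz_on UNIV g"
begin

lemma continuous_on_translate: "continuous_on UNIV (\<lambda>q. g (x + q))"
  by (intro continuous_on_compose2[OF lipschitz_on_continuous_on[OF lip]] continuous_intros) auto

lemma mollify_diff: "mollify \<rho> g x - mollify \<rho> g y = (LINT q|lborel. \<rho> q * (g (x + q) - g (y + q)))"
  unfolding mollify_def
  by (subst Bochner_Integration.integral_diff[symmetric])
     (auto intro!: kernel_integrable continuous_on_translate Bochner_Integration.integral_cong simp: right_diff_distrib)

lemma mollify_lipschitz: "L-lipschitz_on UNIV (mollify \<rho> g)"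
proof (rule lipschitz_onI)
  fix x y
  have "\<bar>mollify \<rho> g x - mollify \<rho> g y\<bar> \<le> L * dist x y"
    unfolding mollify_diff
  proof (rule kernel_average_le)
    show "continuous_on UNIV (\<lambda>q. g (x + q) - g (y + q))" by (intro continuous_intros continuous_on_translate)
    show "\<bar>g (x + q) - g (y + q)\<bar> \<le> L * dist x y" for q
      using lipschitz_onD[OF lip, of "x + q" "y + q"] by (simp add: dist_real_def)
  qed
  thus "dist (mollify \<rho> g x) (mollify \<rho> g y) \<le> L * dist x y" by (simp add: dist_real_def)
qed (rule lipschitz_on_nonneg[OF lip])

lemma mollify_close: "\<bar>mollify \<rho> g x - g x\<bar> \<le> L * \<epsilon>"
proof -
  note K = lipschitz_kernelD[OF kernel]
  have "mollify \<rho> g x - g x = (LINT q|lborel. \<rho> q * g (x + q)) - (LINT q|lborel. \<rho> q * g x)"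
    using K(4) by (simp add: mollify_def)
  also have "\<dots> = (LINT q|lborel. \<rho> q * (g (x + q) - g x))"
    using kernel_integrable[of "\<lambda>_. 1"]
    by (subst Bochner_Integration.integral_diff[symmetric])
       (auto intro!: kernel_integrable continuous_on_translate Bochner_Integration.integral_cong continuous_intros
         simp: right_diff_distrib simp del: integrable_mult_left_iff integral_mult_left_zero)
  also have "\<bar>\<dots>\<bar> \<le> L * \<epsilon>"
  proof (rule kernel_average_le)
    show "continuous_on UNIV (\<lambda>q. g (x + q) - g x)" by (intro continuous_intros continuous_on_translate)
    fix q :: 'a assume "norm q < \<epsilon>"
    hence "L * norm q \<le> L * \<epsilon>" using lipschitz_on_nonneg[OF lip] by (intro mult_left_mono) auto
    thus "\<bar>g (x + q) - g x\<bar> \<le> L * \<epsilon>"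
      using lipschitz_onD[OF lip, of "x + q" x] by (simp add: dist_norm)
  qed
  finally show ?thesis .
qed

text \<open>The increment of the mollification of \<open>k = g (\<cdot> + y) - g\<close> under a shift by \<open>x\<close> can be moved to the
  kernel by translation invariance; there \<open>k\<close> costs a factor \<open>L \<bar>y\<bar>\<close> and the kernel a factor
  \<open>B \<bar>x\<bar>\<close> on a bounded set.\<close>
lemma mollify_second_difference:
  obtains C where "0 \<le> C" "\<And>P x y. norm x \<le> 1 \<Longrightarrow>
    \<bar>mollify \<rho> g (P + x + y) - mollify \<rho> g (P + x) - (mollify \<rho> g (P + y) - mollify \<rho> g P)\<bar>
      \<le> C * norm x * norm y"
proof -
  note K = lipschitz_kernelD[OF kernel]
  let ?V = "measure lborel (cball (0::'a) (\<epsilon> + 1))"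
  have L0: "0 \<le> L" and B0: "0 \<le> B" using lip K(1) by (auto dest: lipschitz_on_nonneg)
  show thesis
  proof
    show "0 \<le> B * L * ?V" using L0 B0 by simp
    fix P x y :: 'a assume x: "norm x \<le> 1"
    define k where "k q = g (P + y + q) - g (P + q)" for q
    have contk: "continuous_on UNIV k" unfolding k_def by (intro continuous_intros continuous_on_translate)
    have contr: "continuous_on UNIV (\<lambda>q. \<rho> (q - x))"
      by (rule continuous_on_compose2[OF K(5)]) (auto intro!: continuous_intros)
    have k_le: "\<bar>k q\<bar> \<le> L * norm y" for q
      using lipschitz_onD[OF lip, of "P + y + q" "P + q"] by (simp add: k_def dist_norm)
    have "mollify \<rho> g (P + x + y) - mollify \<rho> g (P + x) = (LINT q|lborel. \<rho> q * k (q + x))"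
      unfolding mollify_diff k_def by (simp add: algebra_simps)
    also have "\<dots> = (LINT q|distr lborel borel ((+) x). \<rho> (q - x) * k q)"
      using contr contk
      by (subst integral_distr)
         (auto simp: add.commute intro!: borel_measurable_continuous_onI continuous_intros)
    also have "\<dots> = (LINT q|lborel. \<rho> (q - x) * k q)" by (simp add: lborel_distr_plus)
    finally have 1: "mollify \<rho> g (P + x + y) - mollify \<rho> g (P + x) = (LINT q|lborel. \<rho> (q - x) * k q)" .
    have 2: "mollify \<rho> g (P + y) - mollify \<rho> g P = (LINT q|lborel. \<rho> q * k q)"
      unfolding mollify_diff k_def ..
    have supp: "\<rho> (q - x) = 0 \<and> \<rho> q = 0" if "\<epsilon> + 1 < norm q" for q
      using norm_triangle_sub[of q x] that x K(3) by auto
    have "(LINT q|lborel. \<rho> (q - x) * k q) - (LINT q|lborel. \<rho> q * k q)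
        = (LINT q|lborel. (\<rho> (q - x) - \<rho> q) * k q)"
      using supp
      by (subst Bochner_Integration.integral_diff[symmetric])
         (auto intro!: integrable_continuous_compact_support[of _ "\<epsilon> + 1"] continuous_intros contr contk K(5)
           simp: left_diff_distrib)
    also have "\<bar>\<dots>\<bar> \<le> (LINT q|lborel. \<bar>(\<rho> (q - x) - \<rho> q) * k q\<bar>)"
      by (rule integral_abs_bound)
    also have "\<dots> \<le> (LINT q|lborel. B * norm x * (L * norm y) * indicator (cball (0::'a) (\<epsilon> + 1)) q)"
    proof (rule integral_mono)
      show "integrable lborel (\<lambda>q. \<bar>(\<rho> (q - x) - \<rho> q) * k q\<bar>)" using supp
        by (auto intro!: integrable_continuous_compact_support[of _ "\<epsilon> + 1"] continuous_intros contr contk K(5))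
      show "integrable lborel (\<lambda>q. B * norm x * (L * norm y) * indicator (cball (0::'a) (\<epsilon> + 1)) q)"
        by (intro integrable_mult_right integrable_real_indicator)
           (use emeasure_lborel_cball_finite[of "0 :: 'a" "\<epsilon> + 1"] in \<open>auto simp: top.not_eq_extremum\<close>)
      fix q
      have "\<bar>\<rho> (q - x) - \<rho> q\<bar> \<le> B * norm x"
        using lipschitz_onD[OF K(1), of "q - x" q] by (simp add: dist_norm)
      hence "\<bar>(\<rho> (q - x) - \<rho> q) * k q\<bar> \<le> B * norm x * (L * norm y)"
        unfolding abs_mult using B0 by (intro mult_mono k_le) auto
      thus "\<bar>(\<rho> (q - x) - \<rho> q) * k q\<bar> \<le> B * norm x * (L * norm y) * indicator (cball 0 (\<epsilon> + 1)) q"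
        using supp[of q] by (auto simp: indicator_def)
    qed
    also have "\<dots> = B * L * ?V * norm x * norm y" by simp
    finally show "\<bar>mollify \<rho> g (P + x + y) - mollify \<rho> g (P + x) - (mollify \<rho> g (P + y) - mollify \<rho> g P)\<bar>
      \<le> B * L * ?V * norm x * norm y" unfolding 1 2 .
  qed
qed

text \<open>The heart of the argument. By the quadratic estimate, the increment of the mollification along
  \<open>h v\<close> is, up to \<open>O(h\<^sup>2)\<close>, an average of the coordinate increments of \<open>g\<close> itself around \<open>P\<close>.
  Divided by \<open>h\<close> these tend almost everywhere to \<open>\<Sum>\<^sub>e v\<^sub>e \<partial>\<^sub>e g\<close>, which the equation turns into
  \<open>c + \<Sum>\<^sub>e (v - b)\<^sub>e \<partial>\<^sub>e g\<close>, and \<open>\<bar>\<partial>\<^sub>e g\<bar> \<le> L\<close>. Thus \<open>P\<close> itself may lie in the null set where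
  the equation fails.\<close>
lemma mollify_increment_along_direction:
  fixes P v :: 'a and h :: "nat \<Rightarrow> real"
  assumes h: "\<And>n. 0 < h n" "h \<longlonglongrightarrow> 0"
    and pde: "AE q in lborel. norm q < \<epsilon> \<longrightarrow> transport_equation_at g b c (P + q)"
    and M: "\<And>q. norm q < \<epsilon> \<Longrightarrow>
      \<bar>\<kappa> - c (P + q)\<bar> + L * (\<Sum>e\<in>Basis. \<bar>(v - b (P + q)) \<bullet> e\<bar>) \<le> M"
    and "0 < \<eta>"
  shows "\<forall>\<^sub>F n in sequentially.
    \<bar>mollify \<rho> g (P + h n *\<^sub>R v) - mollify \<rho> g P - h n * \<kappa>\<bar> \<le> (M + \<eta>) * h n"
proof -
  note K = lipschitz_kernelD[OF kernel]
  have L0: "0 \<le> L" by (rule lipschitz_on_nonneg[OF lip])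
  define N where "N = (\<Sum>e\<in>Basis. \<bar>v \<bullet> e\<bar>)"
  define y where "y n e = (h n * (v \<bullet> e)) *\<^sub>R e" for n and e :: 'a
  have norm_y: "norm (y n e) = h n * \<bar>v \<bullet> e\<bar>" if "e \<in> Basis" for n e
    using that h(1)[of n] by (simp add: y_def abs_mult)
  have sum_y: "(\<Sum>e\<in>Basis. y n e) = h n *\<^sub>R v" for n
    unfolding y_def by (simp add: scaleR_scaleR[symmetric] scaleR_sum_right[symmetric]
        euclidean_representation del: scaleR_scaleR)
  define r where "r n q = (\<Sum>e\<in>Basis. (g (P + y n e + q) - g (P + q)) / h n) - \<kappa>" for n q
  have contr: "continuous_on UNIV (r n)" for n
    unfolding r_def using h(1)[of n]
    by (intro continuous_intros continuous_on_translate) auto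
  \<comment> \<open>Only the excess over \<open>M\<close> has to disappear in the limit. Its limit is the zero
  function, so the measurability of the partial derivatives never comes up.\<close>
  define f where "f n q = \<rho> q * max 0 (\<bar>r n q\<bar> - M)" for n q
  have intf: "integrable lborel (f n)" for n
    unfolding f_def by (intro kernel_integrable continuous_intros contr)
  have r_le: "\<bar>r n q\<bar> \<le> L * N + \<bar>\<kappa>\<bar>" for n q
  proof -
    have "\<bar>(g (P + y n e + q) - g (P + q)) / h n\<bar> \<le> L * \<bar>v \<bullet> e\<bar>" if "e \<in> Basis" for e
      using lipschitz_onD[OF lip, of "P + y n e + q" "P + q"] norm_y[OF that, of n] h(1)[of n]
      by (simp add: dist_norm abs_divide pos_divide_le_eq mult_ac)
    hence "\<bar>\<Sum>e\<in>Basis. (g (P + y n e + q) - g (P + q)) / h n\<bar> \<le> L * N"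
      unfolding N_def sum_distrib_left by (intro order_trans[OF sum_abs] sum_mono)
    thus ?thesis unfolding r_def by linarith
  qed
  have "(\<lambda>n. LINT q|lborel. f n q) \<longlonglongrightarrow> (LINT q|(lborel::'a measure). 0)"
  proof (rule integral_dominated_convergence)
    show "integrable lborel (\<lambda>q. \<rho> q * (L * N + \<bar>\<kappa>\<bar> + \<bar>M\<bar>))"
      by (intro kernel_integrable continuous_intros)
    show "f n \<in> borel_measurable lborel" for n using intf by (rule borel_measurable_integrable)
    show "AE q in lborel. norm (f n q) \<le> \<rho> q * (L * N + \<bar>\<kappa>\<bar> + \<bar>M\<bar>)" for n
    proof (rule AE_I2)
      fix q :: 'a
      have "max 0 (\<bar>r n q\<bar> - M) \<le> L * N + \<bar>\<kappa>\<bar> + \<bar>M\<bar>" using r_le[of n q] by auto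
      thus "norm (f n q) \<le> \<rho> q * (L * N + \<bar>\<kappa>\<bar> + \<bar>M\<bar>)"
        unfolding f_def using K(2)[of q] by (simp add: abs_mult mult_left_mono)
    qed
    show "AE q in lborel. (\<lambda>n. f n q) \<longlonglongrightarrow> 0"
      using pde
    proof eventually_elim
      case (elim q)
      show ?case
      proof (cases "norm q < \<epsilon>")
        case True
        then obtain D where D: "\<And>e. e \<in> Basis \<Longrightarrow> ((\<lambda>s. g (P + q + s *\<^sub>R e)) has_real_derivative D e) (at 0)"
          and eq: "(\<Sum>e\<in>Basis. (b (P + q) \<bullet> e) * D e) = c (P + q)"
          using elim by (auto simp: transport_equation_at_def)
        have D_le: "\<bar>D e\<bar> \<le> L" if "e \<in> Basis" for e
        proof (rule tendsto_upperbound)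
          show "((\<lambda>s. \<bar>(g (P + q + s *\<^sub>R e) - g (P + q)) / s\<bar>) \<longlongrightarrow> \<bar>D e\<bar>) (at 0)"
            using D[OF that] by (intro tendsto_rabs) (simp add: has_field_derivative_def has_derivative_at DERIV_def flip: has_field_derivative_def)
          show "\<forall>\<^sub>F s in at 0. \<bar>(g (P + q + s *\<^sub>R e) - g (P + q)) / s\<bar> \<le> L"
            unfolding eventually_at
          proof (intro exI[of _ 1] conjI ballI impI)
            fix s :: real assume "s \<noteq> 0 \<and> dist s 0 < 1"
            thus "\<bar>(g (P + q + s *\<^sub>R e) - g (P + q)) / s\<bar> \<le> L"
              using lipschitz_onD[OF lip, of "P + q + s *\<^sub>R e" "P + q"] that
              by (simp add: dist_norm abs_divide pos_divide_le_eq)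
          qed auto
        qed auto
        have "(\<lambda>n. (g (P + y n e + q) - g (P + q)) / h n) \<longlonglongrightarrow> (v \<bullet> e) * D e" if "e \<in> Basis" for e
        proof -
          have "((\<lambda>s. g (P + q + (s * (v \<bullet> e)) *\<^sub>R e)) has_real_derivative D e * (v \<bullet> e)) (at 0)"
            using D[OF that] by (intro DERIV_chain2[where f = "\<lambda>s. g (P + q + s *\<^sub>R e)"])
              (auto intro!: derivative_eq_intros)
          hence "((\<lambda>s. (g (P + q + (s * (v \<bullet> e)) *\<^sub>R e) - g (P + q)) / s) \<longlongrightarrow> D e * (v \<bullet> e)) (at 0)"
            by (simp add: DERIV_def)
          hence "(\<lambda>n. (g (P + q + (h n * (v \<bullet> e)) *\<^sub>R e) - g (P + q)) / h n) \<longlonglongrightarrow> D e * (v \<bullet> e)"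
            by (rule filterlim_compose) (use h in \<open>auto simp: filterlim_at less_le\<close>)
          thus ?thesis by (simp add: y_def algebra_simps)
        qed
        hence "(\<lambda>n. r n q) \<longlonglongrightarrow> (\<Sum>e\<in>Basis. (v \<bullet> e) * D e) - \<kappa>"
          unfolding r_def by (intro tendsto_intros)
        hence "(\<lambda>n. f n q) \<longlonglongrightarrow> \<rho> q * max 0 (\<bar>(\<Sum>e\<in>Basis. (v \<bullet> e) * D e) - \<kappa>\<bar> - M)"
          unfolding f_def by (intro tendsto_intros)
        moreover have "\<bar>(\<Sum>e\<in>Basis. (v \<bullet> e) * D e) - \<kappa>\<bar> \<le> M"
        proof -
          have "(\<Sum>e\<in>Basis. (v \<bullet> e) * D e) - \<kappa>
              = (c (P + q) - \<kappa>) + (\<Sum>e\<in>Basis. ((v - b (P + q)) \<bullet> e) * D e)"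
            using eq by (simp add: inner_diff_left left_diff_distrib sum_subtractf)
          moreover have "\<bar>\<Sum>e\<in>Basis. ((v - b (P + q)) \<bullet> e) * D e\<bar>
              \<le> L * (\<Sum>e\<in>Basis. \<bar>(v - b (P + q)) \<bullet> e\<bar>)"
            unfolding sum_distrib_left
            by (intro order_trans[OF sum_abs] sum_mono)
               (simp add: abs_mult mult.commute[of L] mult_left_mono D_le)
          ultimately show ?thesis using M[OF True] by linarith
        qed
        ultimately show ?thesis by simp
      qed (simp add: f_def K(3))
    qed
  qed auto
  hence f_lim: "(\<lambda>n. LINT q|lborel. f n q) \<longlonglongrightarrow> 0" by simp
  obtain C where C: "0 \<le> C" "\<And>P x y. norm x \<le> 1 \<Longrightarrow>
    \<bar>mollify \<rho> g (P + x + y) - mollify \<rho> g (P + x) - (mollify \<rho> g (P + y) - mollify \<rho> g P)\<bar>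
      \<le> C * norm x * norm y"
    using mollify_second_difference by blast
  have "(\<lambda>n. C * N\<^sup>2 * h n + (LINT q|lborel. f n q)) \<longlonglongrightarrow> C * N\<^sup>2 * 0 + 0"
    by (intro tendsto_intros h f_lim)
  hence "\<forall>\<^sub>F n in sequentially. C * N\<^sup>2 * h n + (LINT q|lborel. f n q) < \<eta>"
    using \<open>0 < \<eta>\<close> by (intro order_tendstoD(2)) auto
  moreover have "\<forall>\<^sub>F n in sequentially. h n * N < 1"
    using tendsto_mult_left_zero[OF h(2), of N] by (intro order_tendstoD(2)) auto
  ultimately show ?thesis
  proof eventually_elim
    case (elim n)
    let ?m = "mollify \<rho> g"
    have "\<bar>?m (P + (\<Sum>e\<in>Basis. y n e)) - ?m P - (\<Sum>e\<in>Basis. ?m (P + y n e) - ?m P)\<bar>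
        \<le> C * (\<Sum>e\<in>Basis. norm (y n e))\<^sup>2"
      by (rule increment_close_to_sum_of_increments[where \<delta> = 1])
         (use C elim in \<open>auto simp: norm_y N_def sum_distrib_left\<close>)
    hence 1: "\<bar>?m (P + h n *\<^sub>R v) - ?m P - (\<Sum>e\<in>Basis. ?m (P + y n e) - ?m P)\<bar> \<le> C * (h n * N)\<^sup>2"
      by (simp add: sum_y norm_y N_def sum_distrib_left)
    have "(\<Sum>e\<in>Basis. ?m (P + y n e) - ?m P) - h n * \<kappa>
        = (\<Sum>e\<in>Basis. LINT q|lborel. \<rho> q * (g (P + y n e + q) - g (P + q))) - (LINT q|lborel. \<rho> q * (h n * \<kappa>))"
      using K(4) by (simp add: mollify_diff)
    also have "\<dots> = (LINT q|lborel. (\<Sum>e\<in>Basis. \<rho> q * (g (P + y n e + q) - g (P + q))) - \<rho> q * (h n * \<kappa>))"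
    proof -
      have "integrable lborel (\<lambda>q. \<rho> q * (g (P + y n e + q) - g (P + q)))" for e
        by (intro kernel_integrable continuous_intros continuous_on_translate)
      moreover have "integrable lborel (\<lambda>q. \<rho> q * (h n * \<kappa>))"
        by (intro kernel_integrable continuous_intros)
      ultimately show ?thesis
        by (subst Bochner_Integration.integral_diff)
           (auto simp only: Bochner_Integration.integral_sum intro!: Bochner_Integration.integrable_sum)
    qed
    also have "\<dots> = (LINT q|lborel. \<rho> q * (h n * r n q))"
    proof -
      have "h n * r n q = (\<Sum>e\<in>Basis. g (P + y n e + q) - g (P + q)) - h n * \<kappa>" for q
        using h(1)[of n] unfolding r_def right_diff_distrib[of "h n"] sum_distrib_left by simp
      thus ?thesis by (simp add: right_diff_distrib[of "\<rho> _"] sum_distrib_left)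
    qed
    finally have 2: "\<bar>(\<Sum>e\<in>Basis. ?m (P + y n e) - ?m P) - h n * \<kappa>\<bar> = \<bar>LINT q|lborel. \<rho> q * (h n * r n q)\<bar>"
      by simp
    also have "\<dots> \<le> (LINT q|lborel. \<bar>\<rho> q * (h n * r n q)\<bar>)" by (rule integral_abs_bound)
    also have "\<dots> \<le> (LINT q|lborel. h n * (\<rho> q * M + f n q))"
    proof (rule integral_mono)
      show "integrable lborel (\<lambda>q. \<bar>\<rho> q * (h n * r n q)\<bar>)"
        by (intro integrable_abs kernel_integrable continuous_intros contr)
      show "integrable lborel (\<lambda>q. h n * (\<rho> q * M + f n q))"
        by (intro integrable_mult_right Bochner_Integration.integrable_add intf kernel_integrable continuous_intros)
      fix q
      have "\<bar>r n q\<bar> \<le> M + max 0 (\<bar>r n q\<bar> - M)" by simp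
      hence "h n * (\<rho> q * \<bar>r n q\<bar>) \<le> h n * (\<rho> q * (M + max 0 (\<bar>r n q\<bar> - M)))"
        using h(1)[of n] K(2)[of q] by (intro mult_left_mono) auto
      thus "\<bar>\<rho> q * (h n * r n q)\<bar> \<le> h n * (\<rho> q * M + f n q)"
        using h(1)[of n] K(2)[of q] by (simp add: f_def abs_mult distrib_left mult_ac)
    qed
    also have "\<dots> = h n * (M + (LINT q|lborel. f n q))"
      using kernel_integrable[of "\<lambda>_. 1"] K(4) by (simp add: intf)
    finally have "\<bar>?m (P + h n *\<^sub>R v) - ?m P - h n * \<kappa>\<bar>
        \<le> C * (h n * N)\<^sup>2 + h n * (M + (LINT q|lborel. f n q))"
      using 1 by linarith
    also have "\<dots> = (M + (C * N\<^sup>2 * h n + (LINT q|lborel. f n q))) * h n"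
      by (simp add: power2_eq_square algebra_simps)
    also have "\<dots> \<le> (M + \<eta>) * h n"
      using elim h(1)[of n] by (intro mult_right_mono) auto
    finally show ?case .
  qed
qed

end

end

section \<open>Transport of Lipschitz solutions along curves\<close>

lemma vector_derivative_increment_along_sequence:
  fixes p :: "real \<Rightarrow> 'a::real_normed_vector"
  assumes "(p has_vector_derivative v) (at \<tau> within S)"
    and h: "\<And>n. 0 < h n" "h \<longlonglongrightarrow> 0" "\<And>n. \<tau> + h n \<in> S" and "0 < \<eta>"
  shows "\<forall>\<^sub>F n in sequentially. norm (p (\<tau> + h n) - p \<tau> - h n *\<^sub>R v) \<le> \<eta> * h n"
proof -
  obtain d where "d > 0" and d: "\<And>y. y \<in> S \<Longrightarrow> norm (y - \<tau>) < d \<Longrightarrow>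
      norm (p y - p \<tau> - (y - \<tau>) *\<^sub>R v) \<le> \<eta> * norm (y - \<tau>)"
    using assms(1) \<open>0 < \<eta>\<close> unfolding has_vector_derivative_def has_derivative_within_alt by blast
  have "\<forall>\<^sub>F n in sequentially. h n < d" using h(2) \<open>d > 0\<close> by (rule order_tendstoD(2))
  thus ?thesis
  proof eventually_elim
    case (elim n)
    with d[OF h(3), of n] h(1)[of n] show ?case by simp
  qed
qed

text \<open>Every time is followed by later times up to which \<open>w - mollify \<rho> g \<circ> p\<close> changes by at most
  \<open>M + \<eta>\<close> per unit of time, for any \<open>\<eta> > 0\<close>. For a continuous function this one-sided
  information along a sequence already bounds the total increment.\<close>
lemma mollified_transport_along_curve:
  fixes g :: "'a::euclidean_space \<Rightarrow> real" and p v :: "real \<Rightarrow> 'a"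
  assumes kernel: "lipschitz_kernel \<epsilon> B \<rho>" and lip: "L-lipschitz_on UNIV g" and "s \<le> t"
    and p: "\<And>\<tau>. \<tau> \<in> {s..t} \<Longrightarrow> (p has_vector_derivative v \<tau>) (at \<tau> within {s..t})"
    and w: "\<And>\<tau>. \<tau> \<in> {s..t} \<Longrightarrow> (w has_vector_derivative \<kappa> \<tau>) (at \<tau> within {s..t})"
    and pde: "\<And>\<tau>. \<tau> \<in> {s..t} \<Longrightarrow>
      AE q in lborel. norm q < \<epsilon> \<longrightarrow> transport_equation_at g b c (p \<tau> + q)"
    and M: "\<And>\<tau> q. \<tau> \<in> {s..t} \<Longrightarrow> norm q < \<epsilon> \<Longrightarrow>
      \<bar>\<kappa> \<tau> - c (p \<tau> + q)\<bar> + L * (\<Sum>e\<in>Basis. \<bar>(v \<tau> - b (p \<tau> + q)) \<bullet> e\<bar>) \<le> M"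
  shows "\<bar>(w t - mollify \<rho> g (p t)) - (w s - mollify \<rho> g (p s))\<bar> \<le> M * (t - s)"
proof -
  define \<phi> where "\<phi> \<tau> = w \<tau> - mollify \<rho> g (p \<tau>)" for \<tau>
  have L0: "0 \<le> L" by (rule lipschitz_on_nonneg[OF lip])
  note lipm = mollify_lipschitz[OF kernel lip]
  have cont: "continuous_on {s..t} \<phi>"
    unfolding \<phi>_def
    by (intro continuous_intros continuous_on_compose2[OF lipschitz_on_continuous_on[OF lipm]]
          continuous_on_vector_derivative[OF p] continuous_on_vector_derivative[OF w]) auto
  have le: "dist (\<phi> t) (\<phi> s) \<le> (M + \<eta>) * (t - s)" if "0 < \<eta>" for \<eta>
  proof (rule locally_lipschitz_imp_lipschitz_aux[OF \<open>s \<le> t\<close> cont])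
    fix \<tau> assume \<tau>: "\<tau> \<in> {s..<t}"
    hence \<tau>': "\<tau> \<in> {s..t}" by simp
    define h where "h n = (t - \<tau>) * inverse (real (Suc n))" for n
    have "(\<lambda>n. (t - \<tau>) * inverse (real (Suc n))) \<longlonglongrightarrow> (t - \<tau>) * 0"
      by (intro tendsto_intros LIMSEQ_inverse_real_of_nat)
    hence h: "\<And>n. 0 < h n" "h \<longlonglongrightarrow> 0"
      using \<tau> by (auto simp: h_def[abs_def])
    have "h n \<le> t - \<tau>" for n
      using \<tau> mult_left_mono[of "inverse (real (Suc n))" 1 "t - \<tau>"] by (simp add: h_def inverse_le_1_iff)
    hence hS: "\<tau> + h n \<in> {s..t}" "\<tau> + h n \<in> {\<tau><..t}" for n
      using h(1)[of n] \<tau> by (auto simp: algebra_simps)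
    define \<eta>' where "\<eta>' = \<eta> / (2 + L)"
    have "\<eta>' + L * \<eta>' + \<eta>' = (2 + L) * \<eta>'" by (simp add: algebra_simps)
    hence \<eta>': "0 < \<eta>'" "\<eta>' + L * \<eta>' + \<eta>' = \<eta>"
      using that L0 by (auto simp: \<eta>'_def)
    have "\<forall>\<^sub>F n in sequentially. norm (p (\<tau> + h n) - p \<tau> - h n *\<^sub>R v \<tau>) \<le> \<eta>' * h n"
      by (rule vector_derivative_increment_along_sequence[OF p[OF \<tau>'] h hS(1) \<eta>'(1)])
    moreover have "\<forall>\<^sub>F n in sequentially. norm (w (\<tau> + h n) - w \<tau> - h n *\<^sub>R \<kappa> \<tau>) \<le> \<eta>' * h n"
      by (rule vector_derivative_increment_along_sequence[OF w[OF \<tau>'] h hS(1) \<eta>'(1)])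
    moreover have "\<forall>\<^sub>F n in sequentially.
        \<bar>mollify \<rho> g (p \<tau> + h n *\<^sub>R v \<tau>) - mollify \<rho> g (p \<tau>) - h n * \<kappa> \<tau>\<bar> \<le> (M + \<eta>') * h n"
      by (rule mollify_increment_along_direction[OF kernel lip h pde[OF \<tau>'] M[OF \<tau>'] \<eta>'(1)])
    ultimately have "\<forall>\<^sub>F n in sequentially. dist (\<phi> (\<tau> + h n)) (\<phi> \<tau>) \<le> (M + \<eta>) * h n"
    proof eventually_elim
      case (elim n)
      have "\<bar>mollify \<rho> g (p (\<tau> + h n)) - mollify \<rho> g (p \<tau> + h n *\<^sub>R v \<tau>)\<bar> \<le> L * (\<eta>' * h n)"
        using lipschitz_onD[OF lipm, of "p (\<tau> + h n)" "p \<tau> + h n *\<^sub>R v \<tau>"]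
          mult_left_mono[OF elim(1) L0]
        by (simp add: dist_norm algebra_simps)
      hence "dist (\<phi> (\<tau> + h n)) (\<phi> \<tau>) \<le> \<eta>' * h n + L * (\<eta>' * h n) + (M + \<eta>') * h n"
        using elim(2,3) by (simp add: \<phi>_def dist_real_def)
      also have "\<dots> = (M + (\<eta>' + L * \<eta>' + \<eta>')) * h n" by (simp add: algebra_simps)
      finally show ?case by (simp add: \<eta>'(2))
    qed
    then obtain n where "dist (\<phi> (\<tau> + h n)) (\<phi> \<tau>) \<le> (M + \<eta>) * h n"
      using eventually_happens'[OF sequentially_bot] by blast
    thus "\<exists>y\<in>{\<tau><..t}. dist (\<phi> y) (\<phi> \<tau>) \<le> (M + \<eta>) * (y - \<tau>)"
      using hS(2)[of n] by (intro bexI[of _ "\<tau> + h n"]) auto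
  qed
  have "dist (\<phi> t) (\<phi> s) \<le> M * (t - s)"
  proof (rule field_le_epsilon)
    fix \<eta> :: real assume "0 < \<eta>"
    define \<eta>' where "\<eta>' = \<eta> / (t - s + 1)"
    have "0 < \<eta>'" "\<eta>' * (t - s) \<le> \<eta>"
      using \<open>0 < \<eta>\<close> \<open>s \<le> t\<close> by (auto simp: \<eta>'_def field_simps)
    thus "dist (\<phi> t) (\<phi> s) \<le> M * (t - s) + \<eta>"
      using le[of \<eta>'] by (simp add: distrib_right)
  qed
  thus ?thesis by (simp add: \<phi>_def dist_real_def)
qed

text \<open>The mollification radius tends to 0, so the data are compared only near the curve, and the
  bound on them may deteriorate linearly with the distance to it. The deviation \<open>v - b\<close> is kept in
  the bound because the estimate is needed for a curve that is not yet known to be characteristic.\<close>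
lemma transport_along_curve:
  fixes g :: "'a::euclidean_space \<Rightarrow> real" and p v :: "real \<Rightarrow> 'a"
  assumes lip: "L-lipschitz_on UNIV g" and "s \<le> t" and "0 < r"
    and p: "\<And>\<tau>. \<tau> \<in> {s..t} \<Longrightarrow> (p has_vector_derivative v \<tau>) (at \<tau> within {s..t})"
    and w: "\<And>\<tau>. \<tau> \<in> {s..t} \<Longrightarrow> (w has_vector_derivative \<kappa> \<tau>) (at \<tau> within {s..t})"
    and pde: "AE x in lborel. (\<exists>\<tau>\<in>{s..t}. dist (p \<tau>) x < r) \<longrightarrow> transport_equation_at g b c x"
    and M: "\<And>\<tau> x. \<tau> \<in> {s..t} \<Longrightarrow> dist (p \<tau>) x < r \<Longrightarrow>
      \<bar>\<kappa> \<tau> - c x\<bar> + L * (\<Sum>e\<in>Basis. \<bar>(v \<tau> - b x) \<bullet> e\<bar>) \<le> M + K * dist (p \<tau>) x"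
    and "0 \<le> K"
  shows "\<bar>(w t - g (p t)) - (w s - g (p s))\<bar> \<le> M * (t - s)"
proof (rule tendsto_lowerbound)
  define E where "E \<epsilon> = (M + K * \<epsilon>) * (t - s) + 2 * L * \<epsilon>" for \<epsilon>
  have "(E \<longlongrightarrow> (M + K * 0) * (t - s) + 2 * L * 0) (at_right 0)"
    unfolding E_def by (intro tendsto_intros)
  thus "(E \<longlongrightarrow> M * (t - s)) (at_right 0)" by simp
  show "\<forall>\<^sub>F \<epsilon> in at_right 0. \<bar>(w t - g (p t)) - (w s - g (p s))\<bar> \<le> E \<epsilon>"
    using eventually_at_right_real[OF \<open>0 < r\<close>]
  proof eventually_elim
    case (elim \<epsilon>)
    hence \<epsilon>: "0 < \<epsilon>" "\<epsilon> < r" by auto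
    obtain B and \<rho> :: "'a \<Rightarrow> real" where kernel: "lipschitz_kernel \<epsilon> B \<rho>"
      using lipschitz_kernel_exists[OF \<epsilon>(1)] .
    have "\<bar>(w t - mollify \<rho> g (p t)) - (w s - mollify \<rho> g (p s))\<bar> \<le> (M + K * \<epsilon>) * (t - s)"
    proof (rule mollified_transport_along_curve[OF kernel lip \<open>s \<le> t\<close> p w])
      fix \<tau> assume \<tau>: "\<tau> \<in> {s..t}"
      obtain N where N: "N \<in> null_sets lborel"
        and pdeN: "\<And>x. (\<exists>\<tau>\<in>{s..t}. dist (p \<tau>) x < r) \<Longrightarrow> x \<notin> N \<Longrightarrow> transport_equation_at g b c x"
        using pde unfolding eventually_ae_filter by auto
      have "{q. q - (- p \<tau>) \<in> N} \<in> null_sets lborel" by (rule null_sets_translation[OF N])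
      from AE_not_in[OF this]
      show "AE q in lborel. norm q < \<epsilon> \<longrightarrow> transport_equation_at g b c (p \<tau> + q)"
      proof eventually_elim
        case (elim q)
        thus ?case using \<epsilon>(2) \<tau>
          by (intro impI pdeN) (auto simp: dist_norm add.commute intro!: bexI[of _ \<tau>])
      qed
      fix q :: 'a assume q: "norm q < \<epsilon>"
      have "K * norm q \<le> K * \<epsilon>" using q \<open>0 \<le> K\<close> by (intro mult_left_mono) auto
      thus "\<bar>\<kappa> \<tau> - c (p \<tau> + q)\<bar> + L * (\<Sum>e\<in>Basis. \<bar>(v \<tau> - b (p \<tau> + q)) \<bullet> e\<bar>) \<le> M + K * \<epsilon>"
        using M[OF \<tau>, of "p \<tau> + q"] q \<epsilon>(2) by (simp add: dist_norm)
    qed auto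
    thus "\<bar>(w t - g (p t)) - (w s - g (p s))\<bar> \<le> E \<epsilon>"
      using mollify_close[OF kernel lip, of "p t"] mollify_close[OF kernel lip, of "p s"]
      unfolding E_def by linarith
  qed
qed simp

section \<open>The master equation along its characteristics\<close>

lemma master_equation_component_transport:
  fixes F G :: "real^'n \<Rightarrow> real^'n \<Rightarrow> real^'n"
  assumes "master_equation_at F G U t x"
  shows "transport_equation_at (\<lambda>(t, x). U t x $ i) (\<lambda>(t, x). (1, F x (U t x)))
    (\<lambda>(t, x). G x (U t x) $ i) (t, x)"
proof -
  obtain Ut DU where Ut: "((\<lambda>s. U s x) has_vector_derivative Ut) (at t)"
    and DU: "\<And>i j. ((\<lambda>s. U t (x + s *\<^sub>R axis j 1) $ i) has_real_derivative DU i j) (at 0)"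
    and eq: "\<And>i. Ut $ i + (\<Sum>j\<in>UNIV. F x (U t x) $ j * DU i j) = G x (U t x) $ i"
    using assms unfolding master_equation_at_def by blast
  have "((\<lambda>s. U s x $ i) has_vector_derivative Ut $ i) (at t)"
    by (rule bounded_linear.has_vector_derivative[OF bounded_linear_vec_nth Ut])
  hence "((\<lambda>s. U (t + s) x $ i) has_real_derivative Ut $ i) (at 0)"
    unfolding has_real_derivative_iff_has_vector_derivative[symmetric]
    using DERIV_shift[of "\<lambda>s. U s x $ i" "Ut $ i" 0 t] by (simp add: add.commute)
  hence time: "((\<lambda>s. case (t, x) + s *\<^sub>R (1, 0) of (t, x) \<Rightarrow> U t x $ i) has_real_derivative Ut $ i) (at 0)"
    by simp
  have space: "((\<lambda>s. case (t, x) + s *\<^sub>R (0, axis j 1) of (t, x) \<Rightarrow> U t x $ i)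
      has_real_derivative DU i j) (at 0)" for j
    using DU by simp
  have B: "(Basis :: (real^'n) set) = range (\<lambda>j. axis j 1)" by (auto simp: Basis_vec_def)
  \<comment> \<open>Collects the given partial derivatives into one function on the basis of
  space-time: index \<open>(1, 0)\<close> is time, index \<open>(0, axis j 1)\<close> is the coordinate \<open>x\<^sub>j\<close>.\<close>
  define D where "D e = (if fst e = 1 then Ut $ i else DU i (THE j. snd e = axis j 1))"
    for e :: "real \<times> (real^'n)"
  have D: "D (1, 0) = Ut $ i" "D (0, axis j 1) = DU i j" for j
    by (auto simp: D_def axis_eq_axis)
  show ?thesis
    unfolding transport_equation_at_def
  proof (intro exI[of _ D] conjI ballI)
    fix e :: "real \<times> (real^'n)" assume "e \<in> Basis"
    then consider "e = (1, 0)" | j where "e = (0, axis j 1)"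
      by (auto simp: Basis_prod_def B)
    thus "((\<lambda>s. case (t, x) + s *\<^sub>R e of (t, x) \<Rightarrow> U t x $ i) has_real_derivative D e) (at 0)"
      by cases (use time space D in \<open>simp_all only:\<close>)
  next
    have "(\<Sum>e\<in>Basis. (((1::real), F x (U t x)) \<bullet> e) * D e)
        = D (1, 0) + (\<Sum>u\<in>Basis. (F x (U t x) \<bullet> u) * D (0, u))"
      unfolding Basis_prod_def
      by (subst sum.union_disjoint) (auto simp: sum.reindex inj_on_def)
    also have "(\<Sum>u\<in>Basis. (F x (U t x) \<bullet> u) * D (0, u)) = (\<Sum>j\<in>UNIV. F x (U t x) $ j * DU i j)"
      unfolding B by (subst sum.reindex) (auto simp: inj_on_def axis_eq_axis inner_axis D)
    finally show "(\<Sum>e\<in>Basis. ((case (t, x) of (t, x) \<Rightarrow> (1, F x (U t x))) \<bullet> e) * D e)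
        = (case (t, x) of (t, x) \<Rightarrow> G x (U t x) $ i)"
      using eq[of i] by (simp add: D)
  qed
qed

lemma locally_lipschitz_on_imp_continuous_on:
  assumes "locally_lipschitz_on S f"
  shows "continuous_on S f"
  unfolding continuous_on_eq_continuous_within
proof
  fix p assume p: "p \<in> S"
  then obtain r L where r: "r > 0" "L-lipschitz_on (ball p r \<inter> S) f"
    using assms unfolding locally_lipschitz_on_def by blast
  have "continuous (at p within ball p r \<inter> S) f"
    using lipschitz_on_continuous_on[OF r(2)] p r(1) by (simp add: continuous_on_eq_continuous_within)
  moreover have "at p within ball p r \<inter> S = at p within S"
    using r(1) by (intro at_within_nhd[of p "ball p r"]) auto
  ultimately show "continuous (at p within S) f" by simp
qed

lemma locally_lipschitz_on_half_space_cball: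
  fixes f :: "real \<times> 'a::metric_space \<Rightarrow> 'b::metric_space"
  assumes "locally_lipschitz_on ({0<..} \<times> UNIV) f" and "0 < s"
  obtains r L where "0 < r" "cball (s, x) r \<subseteq> {0<..} \<times> UNIV" "L-lipschitz_on (cball (s, x) r) f"
proof -
  obtain R L where R: "R > 0" "L-lipschitz_on (ball (s, x) R \<inter> {0<..} \<times> UNIV) f"
    using assms unfolding locally_lipschitz_on_def by fastforce
  define r where "r = min R s / 2"
  have sub: "cball (s, x) r \<subseteq> {0<..} \<times> UNIV"
  proof
    fix y assume "y \<in> cball (s, x) r"
    hence "dist s (fst y) \<le> r" using dist_fst_le[of "(s, x)" y] by (auto intro: order_trans)
    hence "\<bar>s - fst y\<bar> \<le> s / 2" by (simp add: r_def dist_real_def)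
    hence "0 < fst y" using \<open>0 < s\<close> by linarith
    thus "y \<in> {0<..} \<times> UNIV" by (cases y) auto
  qed
  have r: "0 < r" "r < R" using \<open>0 < s\<close> R(1) by (auto simp: r_def min_def)
  have "L-lipschitz_on (cball (s, x) r) f"
    by (rule lipschitz_on_subset[OF R(2)]) (use sub r in auto)
  thus thesis using that r(1) sub by blast
qed

lemma uncurried_lipschitzD:
  assumes "L-lipschitz_on UNIV (\<lambda>(x, u). F x u)"
  shows "dist (F x u) (F x' u') \<le> L * (dist x x' + dist u u')"
proof -
  have "dist (F x u) (F x' u') \<le> L * dist (x, u) (x', u')"
    using lipschitz_onD[OF assms, of "(x, u)" "(x', u')"] by simp
  also have "\<dots> \<le> L * (dist x x' + dist u u')"
    using lipschitz_on_nonneg[OF assms]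
    by (intro mult_left_mono) (auto simp: dist_Pair_Pair intro: real_le_lsqrt sqrt_sum_squares_le_sum)
  finally show ?thesis .
qed

text \<open>The difference \<open>\<delta> = W - U(\<cdot>, X)\<close> vanishes at \<open>t1\<close>. The curve \<open>(t, X t)\<close> moves with velocity
  \<open>(1, F(X, W))\<close> rather than with the velocity \<open>(1, F(X, U))\<close> of the equation, and \<open>W\<close> grows by
  \<open>G(X, W)\<close> rather than \<open>G(X, U)\<close>; both errors are at most a constant times \<open>\<bar>\<delta>\<bar>\<close>, so the transport
  estimate, applied to each component of \<open>U\<close>, bounds the increments of \<open>\<delta>\<close> by \<open>\<delta>\<close> itself.\<close>
lemma characteristics_carry_solution:
  fixes F G :: "real^'n \<Rightarrow> real^'n \<Rightarrow> real^'n"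
  assumes F: "KF-lipschitz_on UNIV (\<lambda>(x, u). F x u)" and G: "KG-lipschitz_on UNIV (\<lambda>(x, u). G x u)"
    and sol: "master_equation_solution F G U"
    and X: "\<And>t. t \<in> {0<..t1} \<Longrightarrow> (X has_vector_derivative F (X t) (W t)) (at t within {0<..t1})"
    and W: "\<And>t. t \<in> {0<..t1} \<Longrightarrow> (W has_vector_derivative G (X t) (W t)) (at t within {0<..t1})"
    and init: "W t1 = U t1 (X t1)" and t: "t \<in> {0<..t1}"
  shows "W t = U t (X t)"
proof -
  define S where "S = {0<..t1}"
  define \<delta> where "\<delta> \<tau> = W \<tau> - U \<tau> (X \<tau>)" for \<tau>
  define V where "V = (\<lambda>(t, x). U t x)"
  have KF: "0 \<le> KF" and KG: "0 \<le> KG" using F G by (auto dest: lipschitz_on_nonneg)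
  have lipV: "locally_lipschitz_on ({0<..} \<times> UNIV) V"
    and pde: "AE (t, x) in lborel. t > 0 \<longrightarrow> master_equation_at F G U t x"
    using sol by (auto simp: master_equation_solution_def V_def AE_completion_iff)
  have contX: "continuous_on S X" unfolding S_def by (rule continuous_on_vector_derivative[OF X])
  have contW: "continuous_on S W" unfolding S_def by (rule continuous_on_vector_derivative[OF W])
  have "continuous_on S (\<lambda>\<tau>. V (\<tau>, X \<tau>))"
    by (intro continuous_on_compose2[OF locally_lipschitz_on_imp_continuous_on[OF lipV]]
          continuous_intros contX) (auto simp: S_def)
  hence cont\<delta>: "continuous_on S \<delta>"
    unfolding \<delta>_def V_def by (intro continuous_intros contW) auto
  have "\<delta> t = 0"
  proof (rule zero_by_local_increment_bound[of S t1 \<delta> t])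
    fix s assume s: "s \<in> S"
    hence "0 < s" by (simp add: S_def)
    then obtain r L where r: "0 < r" "cball (s, X s) r \<subseteq> {0<..} \<times> UNIV"
      and L: "L-lipschitz_on (cball (s, X s) r) V"
      by (rule locally_lipschitz_on_half_space_cball[OF lipV])
    let ?B = "cball (s, X s) r"
    have L0: "0 \<le> L" by (rule lipschitz_on_nonneg[OF L])
    \<comment> \<open>Composition with the nearest-point projection onto the ball extends \<open>U\<close> to all of
    space with the same Lipschitz constant.\<close>
    define proj where "proj = closest_point ?B"
    have proj_in: "proj y \<in> ?B" for y
      unfolding proj_def by (rule closest_point_in_set) (use r(1) in auto)
    have proj_id: "proj y = y" if "y \<in> ?B" for y
      unfolding proj_def by (rule closest_point_self[OF that])
    have lipg: "L-lipschitz_on UNIV (\<lambda>y. V (proj y) $ i)" for i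
    proof (rule lipschitz_onI[OF _ L0])
      fix x y
      have "dist (V (proj x) $ i) (V (proj y) $ i) \<le> dist (V (proj x)) (V (proj y))"
        by (rule dist_vec_nth_le)
      also have "\<dots> \<le> L * dist (proj x) (proj y)" by (intro lipschitz_onD[OF L] proj_in)
      also have "\<dots> \<le> L * dist x y"
        unfolding proj_def using r(1) by (intro mult_left_mono L0 closest_point_lipschitz) auto
      finally show "dist (V (proj x) $ i) (V (proj y) $ i) \<le> L * dist x y" .
    qed
    \<comment> \<open>Half of the radius is for the curve, the other half for the mollification around it.\<close>
    obtain d where "0 < d" and d: "\<And>\<tau>. \<tau> \<in> S \<Longrightarrow> \<bar>\<tau> - s\<bar> < d \<Longrightarrow> dist (\<tau>, X \<tau>) (s, X s) < r / 2"
    proof -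
      have "continuous_on S (\<lambda>\<tau>. (\<tau>, X \<tau>))" by (intro continuous_intros contX)
      thus thesis using that s r(1) unfolding continuous_on_iff
        by (metis dist_real_def half_gt_zero)
    qed
    define N where "N = real DIM(real \<times> (real^'n))"
    \<comment> \<open>\<open>KG\<close> comes from the right-hand side; on the curve the velocity error is at most \<open>KF \<bar>\<delta>\<bar>\<close> in each of the
    \<open>N\<close> directions of space-time, and the partial derivatives are at most \<open>L\<close>.\<close>
    define C where "C = KG + L * (N * KF)"
    have C: "0 \<le> C" using KF KG L0 by (simp add: C_def N_def)
    have bound: "norm (\<delta> b - \<delta> a) \<le> real CARD('n) * C * M * (b - a)"
      if ab: "a \<in> S" "b \<in> S" "a \<le> b" "\<bar>a - s\<bar> < d" "\<bar>b - s\<bar> < d"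
        and M: "\<And>\<tau>. \<tau> \<in> {a..b} \<Longrightarrow> norm (\<delta> \<tau>) \<le> M" for a b M
    proof -
      have sub: "{a..b} \<subseteq> S" using ab by (auto simp: S_def)
      have near: "dist (\<tau>, X \<tau>) (s, X s) < r / 2" if "\<tau> \<in> {a..b}" for \<tau>
        using that ab sub by (intro d) auto
      have near_B: "y \<in> ball (s, X s) r" if "\<tau> \<in> {a..b}" "dist (\<tau>, X \<tau>) y < r / 2" for \<tau> y
        using dist_triangle_half_r[OF near[OF that(1)] that(2)] by simp
      have "\<bar>\<delta> b $ i - \<delta> a $ i\<bar> \<le> C * M * (b - a)" for i
      proof -
        have "\<bar>(W b $ i - V (proj (b, X b)) $ i) - (W a $ i - V (proj (a, X a)) $ i)\<bar> \<le> C * M * (b - a)"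
        proof (rule transport_along_curve[where p = "\<lambda>\<tau>. (\<tau>, X \<tau>)" and v = "\<lambda>\<tau>. (1, F (X \<tau>) (W \<tau>))"
              and w = "\<lambda>\<tau>. W \<tau> $ i" and \<kappa> = "\<lambda>\<tau>. G (X \<tau>) (W \<tau>) $ i" and K = "C * (1 + L)"
              and b = "\<lambda>(t, x). (1, F x (U t x))" and c = "\<lambda>(t, x). G x (U t x) $ i" and r = "r / 2",
              OF lipg \<open>a \<le> b\<close>])
          show "0 < r / 2" "0 \<le> C * (1 + L)" using r(1) C L0 by auto
          fix \<tau> assume \<tau>: "\<tau> \<in> {a..b}"
          hence \<tau>S: "\<tau> \<in> {0<..t1}" using sub by (auto simp: S_def)
          have sub': "{a..b} \<subseteq> {0<..t1}" using sub by (simp add: S_def)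
          show "((\<lambda>\<tau>. (\<tau>, X \<tau>)) has_vector_derivative (1, F (X \<tau>) (W \<tau>))) (at \<tau> within {a..b})"
            by (intro has_vector_derivative_Pair has_vector_derivative_id
                  has_vector_derivative_within_subset[OF X[OF \<tau>S] sub'])
          show "((\<lambda>\<tau>. W \<tau> $ i) has_vector_derivative G (X \<tau>) (W \<tau>) $ i) (at \<tau> within {a..b})"
            by (intro bounded_linear.has_vector_derivative[OF bounded_linear_vec_nth]
                  has_vector_derivative_within_subset[OF W[OF \<tau>S] sub'])
          fix y :: "real \<times> (real^'n)" assume y: "dist (\<tau>, X \<tau>) y < r / 2"
          obtain t' x' where y_eq: "y = (t', x')" by (cases y)
          let ?D = "dist (\<tau>, X \<tau>) y"
          have inB: "y \<in> ?B" "(\<tau>, X \<tau>) \<in> ?B"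
            using near_B[OF \<tau> y] near_B[OF \<tau>, of "(\<tau>, X \<tau>)"] r(1) by auto
          have "dist (W \<tau>) (U t' x') \<le> norm (\<delta> \<tau>) + dist (U \<tau> (X \<tau>)) (U t' x')"
            using norm_triangle_ineq[of "W \<tau> - U \<tau> (X \<tau>)" "U \<tau> (X \<tau>) - U t' x'"]
            by (simp add: \<delta>_def dist_norm)
          also have "dist (U \<tau> (X \<tau>)) (U t' x') \<le> L * ?D"
            using lipschitz_onD[OF L inB(2,1)] by (simp add: V_def y_eq)
          finally have "dist (X \<tau>) x' + dist (W \<tau>) (U t' x') \<le> M + (1 + L) * ?D"
            using M[OF \<tau>] dist_snd_le[of "(\<tau>, X \<tau>)" y] by (simp add: y_eq algebra_simps)
          hence le: "k * (dist (X \<tau>) x' + dist (W \<tau>) (U t' x')) \<le> k * (M + (1 + L) * ?D)"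
            if "0 \<le> k" for k using that by (intro mult_left_mono)
          have "\<bar>G (X \<tau>) (W \<tau>) $ i - G x' (U t' x') $ i\<bar> \<le> dist (G (X \<tau>) (W \<tau>)) (G x' (U t' x'))"
            using dist_vec_nth_le[of "G (X \<tau>) (W \<tau>)" i] by (simp add: dist_real_def)
          also have "\<dots> \<le> KG * (M + (1 + L) * ?D)"
            using uncurried_lipschitzD[OF G] le[OF KG] by (rule order_trans)
          finally have 1: "\<bar>G (X \<tau>) (W \<tau>) $ i - G x' (U t' x') $ i\<bar> \<le> KG * (M + (1 + L) * ?D)" .
          let ?v = "(1, F (X \<tau>) (W \<tau>)) - (1, F x' (U t' x')) :: real \<times> (real^'n)"
          have "norm ?v = dist (F (X \<tau>) (W \<tau>)) (F x' (U t' x'))"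
            by (simp add: norm_Pair dist_norm)
          also have "\<dots> \<le> KF * (M + (1 + L) * ?D)"
            using uncurried_lipschitzD[OF F] le[OF KF] by (rule order_trans)
          finally have "norm ?v \<le> KF * (M + (1 + L) * ?D)" .
          hence "\<bar>?v \<bullet> e\<bar> \<le> KF * (M + (1 + L) * ?D)" if "e \<in> Basis" for e
            using Basis_le_norm[OF that, of ?v] by linarith
          hence "(\<Sum>e\<in>Basis. \<bar>?v \<bullet> e\<bar>) \<le> N * (KF * (M + (1 + L) * ?D))"
            unfolding N_def by (rule sum_bounded_above)
          hence "L * (\<Sum>e\<in>Basis. \<bar>?v \<bullet> e\<bar>) \<le> L * (N * (KF * (M + (1 + L) * ?D)))"
            by (intro mult_left_mono L0)
          with 1 have "\<bar>G (X \<tau>) (W \<tau>) $ i - G x' (U t' x') $ i\<bar> + L * (\<Sum>e\<in>Basis. \<bar>?v \<bullet> e\<bar>)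
              \<le> C * (M + (1 + L) * ?D)"
            unfolding C_def distrib_right by (simp only: mult.assoc)
          moreover have "C * (M + (1 + L) * ?D) = C * M + C * (1 + L) * ?D"
            by (simp add: algebra_simps)
          ultimately show "\<bar>G (X \<tau>) (W \<tau>) $ i - (case y of (t, x) \<Rightarrow> G x (U t x) $ i)\<bar>
              + L * (\<Sum>e\<in>Basis. \<bar>((1 :: real, F (X \<tau>) (W \<tau>)) - (case y of (t, x) \<Rightarrow> (1, F x (U t x)))) \<bullet> e\<bar>)
              \<le> C * M + C * (1 + L) * ?D"
            by (simp only: y_eq prod.case)
        next
          show "AE y in lborel. (\<exists>\<tau>\<in>{a..b}. dist (\<tau>, X \<tau>) y < r / 2) \<longrightarrow>
              transport_equation_at (\<lambda>y. V (proj y) $ i) (\<lambda>(t, x). (1, F x (U t x)))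
                (\<lambda>(t, x). G x (U t x) $ i) y"
            using pde
          proof eventually_elim
            case (elim y)
            obtain t' x' where y_eq: "y = (t', x')" by (cases y)
            show ?case
            proof
              assume "\<exists>\<tau>\<in>{a..b}. dist (\<tau>, X \<tau>) y < r / 2"
              hence y: "y \<in> ball (s, X s) r" using near_B by blast
              hence "y \<in> ?B" by simp
              hence "y \<in> {0<..} \<times> UNIV" using r(2) by blast
              hence "master_equation_at F G U t' x'" using elim by (simp add: y_eq)
              from master_equation_component_transport[OF this, of i]
              show "transport_equation_at (\<lambda>y. V (proj y) $ i) (\<lambda>(t, x). (1, F x (U t x)))
                (\<lambda>(t, x). G x (U t x) $ i) y"
                unfolding y_eq[symmetric]
                by (rule transport_equation_at_transfer[OF _ open_ball y])
                   (auto simp: proj_id V_def)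
            qed
          qed
        qed
        moreover have "(a, X a) \<in> ?B" "(b, X b) \<in> ?B"
          using near[of a] near[of b] ab(3) r(1) by (auto simp: dist_commute)
        ultimately show ?thesis by (simp add: \<delta>_def proj_id V_def)
      qed
      hence "(\<Sum>i\<in>UNIV. \<bar>(\<delta> b - \<delta> a) $ i\<bar>) \<le> real CARD('n) * (C * M * (b - a))"
        by (intro sum_bounded_above) simp
      thus ?thesis using norm_le_l1_cart[of "\<delta> b - \<delta> a"] by (simp add: mult.assoc)
    qed
    show "\<exists>d>0. \<exists>C. \<forall>a\<in>S. \<forall>b\<in>S. \<forall>M. a \<le> b \<longrightarrow> \<bar>a - s\<bar> < d \<longrightarrow> \<bar>b - s\<bar> < d \<longrightarrow>
        (\<forall>\<tau>\<in>{a..b}. norm (\<delta> \<tau>) \<le> M) \<longrightarrow> norm (\<delta> b - \<delta> a) \<le> C * M * (b - a)"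
      by (intro exI[of _ d] conjI exI[of _ "real CARD('n) * C"] ballI allI impI \<open>0 < d\<close> bound) auto
  qed (use t init cont\<delta> in \<open>auto simp: S_def \<delta>_def\<close>)
  thus ?thesis by (simp add: \<delta>_def)
qed

section \<open>The backward trajectory\<close>

text \<open>The vector field \<open>(t, x) \<mapsto> F(x, U(t, x))\<close> is only locally Lipschitz, so two trajectories are compared
  near a time at which they coincide, where both stay in a ball of Lipschitz continuity.\<close>
lemma backward_trajectory_unique:
  fixes F :: "real^'n \<Rightarrow> real^'n \<Rightarrow> real^'n"
  assumes F: "K-lipschitz_on UNIV (\<lambda>(x, u). F x u)"
    and U: "locally_lipschitz_on ({0<..} \<times> UNIV) (\<lambda>(t, x). U t x)"
    and x: "backward_trajectory F U t1 x1 x" and y: "backward_trajectory F U t1 x1 y"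
    and t: "t \<in> {0<..t1}"
  shows "y t = x t"
proof -
  define S where "S = {0<..t1}"
  define \<delta> where "\<delta> \<tau> = y \<tau> - x \<tau>" for \<tau>
  have K0: "0 \<le> K" by (rule lipschitz_on_nonneg[OF F])
  have derx: "(x has_vector_derivative F (x \<tau>) (U \<tau> (x \<tau>))) (at \<tau> within S)"
    and dery: "(y has_vector_derivative F (y \<tau>) (U \<tau> (y \<tau>))) (at \<tau> within S)" if "\<tau> \<in> S" for \<tau>
    using x y that by (auto simp: backward_trajectory_def S_def)
  have contx: "continuous_on S x" and conty: "continuous_on S y"
    by (rule continuous_on_vector_derivative, erule derx dery)+
  have "\<delta> t = 0"
  proof (rule zero_by_local_increment_bound[of S t1 \<delta> t])
    fix s assume s: "s \<in> S" "\<delta> s = 0"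
    hence "0 < s" by (simp add: S_def)
    then obtain r L where r: "0 < r" and L: "L-lipschitz_on (cball (s, x s) r) (\<lambda>(t, x). U t x)"
      by (rule locally_lipschitz_on_half_space_cball[OF U])
    have near: "\<exists>d>0. \<forall>\<tau>\<in>S. \<bar>\<tau> - s\<bar> < d \<longrightarrow> (\<tau>, z \<tau>) \<in> cball (s, x s) r"
      if "continuous_on S z" "z s = x s" for z
    proof -
      have "continuous_on S (\<lambda>\<tau>. (\<tau>, z \<tau>))" by (intro continuous_intros that)
      with s(1) r obtain d where "d > 0" "\<And>\<tau>. \<tau> \<in> S \<Longrightarrow> dist \<tau> s < d \<Longrightarrow> dist (\<tau>, z \<tau>) (s, z s) < r"
        unfolding continuous_on_iff by metis
      thus ?thesis using that(2)
        by (intro exI[of _ d]) (auto simp: dist_real_def dist_commute less_imp_le)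
    qed
    obtain d1 d2 where d: "d1 > 0" "d2 > 0"
      and d1: "\<And>\<tau>. \<tau> \<in> S \<Longrightarrow> \<bar>\<tau> - s\<bar> < d1 \<Longrightarrow> (\<tau>, x \<tau>) \<in> cball (s, x s) r"
      and d2: "\<And>\<tau>. \<tau> \<in> S \<Longrightarrow> \<bar>\<tau> - s\<bar> < d2 \<Longrightarrow> (\<tau>, y \<tau>) \<in> cball (s, x s) r"
      using near[OF contx] near[OF conty] s(2) by (auto simp: \<delta>_def)
    have bound: "norm (\<delta> b - \<delta> a) \<le> K * (1 + L) * M * (b - a)"
      if ab: "a \<in> S" "b \<in> S" "a \<le> b" "\<bar>a - s\<bar> < min d1 d2" "\<bar>b - s\<bar> < min d1 d2"
        and M: "\<And>\<tau>. \<tau> \<in> {a..b} \<Longrightarrow> norm (\<delta> \<tau>) \<le> M" for a b M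
    proof -
      have sub: "{a..b} \<subseteq> S" using ab by (auto simp: S_def)
      let ?f = "\<lambda>\<tau>. F (y \<tau>) (U \<tau> (y \<tau>)) - F (x \<tau>) (U \<tau> (x \<tau>))"
      have f: "norm (?f \<tau>) \<le> K * (1 + L) * M" if \<tau>: "\<tau> \<in> {a..b}" for \<tau>
      proof -
        have "dist (U \<tau> (y \<tau>)) (U \<tau> (x \<tau>)) \<le> L * norm (\<delta> \<tau>)"
          using lipschitz_onD[OF L d2 d1, of \<tau> \<tau>] \<tau> sub ab
          by (auto simp: \<delta>_def dist_norm norm_Pair)
        hence "dist (y \<tau>) (x \<tau>) + dist (U \<tau> (y \<tau>)) (U \<tau> (x \<tau>)) \<le> (1 + L) * norm (\<delta> \<tau>)"
          by (simp add: \<delta>_def dist_norm distrib_right)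
        also have "\<dots> \<le> (1 + L) * M"
          using M[OF \<tau>] lipschitz_on_nonneg[OF L] by (intro mult_left_mono) auto
        finally show ?thesis
          using order_trans[OF uncurried_lipschitzD[OF F] mult_left_mono[OF _ K0]]
          by (simp add: dist_norm mult.assoc)
      qed
      have "norm (\<delta> b - \<delta> a) \<le> K * (1 + L) * M * norm (b - a)"
      proof (rule differentiable_bound[OF convex_real_interval(5)])
        fix \<tau> assume \<tau>: "\<tau> \<in> {a..b}"
        hence "(\<delta> has_vector_derivative ?f \<tau>) (at \<tau> within {a..b})"
          unfolding \<delta>_def[abs_def] using sub
          by (intro has_vector_derivative_diff has_vector_derivative_within_subset[OF derx]
                has_vector_derivative_within_subset[OF dery]) auto
        thus "(\<delta> has_derivative (\<lambda>h. h *\<^sub>R ?f \<tau>)) (at \<tau> within {a..b})"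
          by (simp add: has_vector_derivative_def)
        show "onorm (\<lambda>h. h *\<^sub>R ?f \<tau>) \<le> K * (1 + L) * M"
          by (rule onorm_le) (use mult_right_mono[OF f[OF \<tau>]] in \<open>simp add: mult.commute\<close>)
      qed (use ab in auto)
      thus ?thesis using ab by simp
    qed
    show "\<exists>d>0. \<exists>C. \<forall>a\<in>S. \<forall>b\<in>S. \<forall>M. a \<le> b \<longrightarrow> \<bar>a - s\<bar> < d \<longrightarrow> \<bar>b - s\<bar> < d \<longrightarrow>
        (\<forall>\<tau>\<in>{a..b}. norm (\<delta> \<tau>) \<le> M) \<longrightarrow> norm (\<delta> b - \<delta> a) \<le> C * M * (b - a)"
      using d
      by (intro exI[of _ "min d1 d2"] conjI exI[of _ "K * (1 + L)"] ballI allI impI bound) auto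
  next
    show "continuous_on S \<delta>" unfolding \<delta>_def by (intro continuous_intros contx conty)
  qed (use x y t in \<open>auto simp: S_def \<delta>_def backward_trajectory_def\<close>)
  thus ?thesis by (simp add: \<delta>_def)
qed

text \<open>The characteristic system is autonomous with a globally Lipschitz right-hand side, so time can be
  reversed and solutions exist on the whole closed interval, including \<open>t = 0\<close>.\<close>
lemma characteristic_system_backward_solution:
  fixes F G :: "'a::euclidean_space \<Rightarrow> 'a \<Rightarrow> 'a"
  assumes F: "KF-lipschitz_on UNIV (\<lambda>(x, u). F x u)" and G: "KG-lipschitz_on UNIV (\<lambda>(x, u). G x u)"
    and "0 \<le> t1"
  obtains X W where "X t1 = x1" "W t1 = u1"
    and "\<And>t. t \<in> {0..t1} \<Longrightarrow> (X has_vector_derivative F (X t) (W t)) (at t within {0..t1})"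
    and "\<And>t. t \<in> {0..t1} \<Longrightarrow> (W has_vector_derivative G (X t) (W t)) (at t within {0..t1})"
proof -
  define \<Phi> where "\<Phi> = (\<lambda>z. - (F (fst z) (snd z), G (fst z) (snd z)))"
  have "(sqrt (KF\<^sup>2 + KG\<^sup>2))-lipschitz_on UNIV \<Phi>"
    unfolding \<Phi>_def
    by (intro lipschitz_on_minus lipschitz_on_Pair) (use F G in \<open>simp_all add: case_prod_beta'\<close>)
  then obtain Y where Y0: "Y 0 = (x1, u1)"
    and Y: "\<And>s. s \<in> {0..t1} \<Longrightarrow> (Y has_vector_derivative \<Phi> (Y s)) (at s within {0..t1})"
    using lipschitz_ode_solution_exists[OF _ \<open>0 \<le> t1\<close>] by metis
  define Z where "Z t = Y (t1 - t)" for t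
  have Z: "(Z has_vector_derivative (F (fst (Z t)) (snd (Z t)), G (fst (Z t)) (snd (Z t))))
      (at t within {0..t1})" if "t \<in> {0..t1}" for t
  proof -
    have img: "(\<lambda>t. t1 - t) ` {0..t1} = {0..t1}"
      by (auto simp: image_iff intro!: bexI[of _ "t1 - _"])
    have "((\<lambda>t. t1 - t) has_vector_derivative -1) (at t within {0..t1})"
      by (auto intro!: derivative_eq_intros)
    moreover have "(Y has_vector_derivative \<Phi> (Y (t1 - t))) (at (t1 - t) within (\<lambda>t. t1 - t) ` {0..t1})"
      unfolding img using that by (intro Y) auto
    ultimately have "(Y \<circ> (\<lambda>t. t1 - t) has_vector_derivative (-1) *\<^sub>R \<Phi> (Y (t1 - t))) (at t within {0..t1})"
      by (rule vector_diff_chain_within)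
    thus ?thesis by (simp add: \<Phi>_def Z_def[abs_def] o_def)
  qed
  show thesis
  proof
    show "fst (Z t1) = x1" "snd (Z t1) = u1" by (simp_all add: Z_def Y0)
    fix t assume "t \<in> {0..t1}"
    note D = Z[OF this]
    show "((\<lambda>t. fst (Z t)) has_vector_derivative F (fst (Z t)) (snd (Z t))) (at t within {0..t1})"
      using bounded_linear.has_vector_derivative[OF bounded_linear_fst D] by simp
    show "((\<lambda>t. snd (Z t)) has_vector_derivative G (fst (Z t)) (snd (Z t))) (at t within {0..t1})"
      using bounded_linear.has_vector_derivative[OF bounded_linear_snd D] by simp
  qed
qed

theorem proposition4:
  fixes F G :: "real^'n \<Rightarrow> real^'n \<Rightarrow> real^'n"
    and U :: "real \<Rightarrow> real^'n \<Rightarrow> real^'n"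
    and x0 x1 :: "real^'n" and t1 :: real
  assumes "globally_lipschitz F" and "globally_lipschitz G"
    and "planning_solution F G x0 U"
    and "t1 > 0"
  shows "\<exists>x. backward_trajectory F U t1 x1 x \<and>
             (\<forall>y. backward_trajectory F U t1 x1 y \<longrightarrow> (\<forall>t\<in>{0<..t1}. y t = x t)) \<and>
             (x \<longlongrightarrow> x0) (at_right 0)"
proof -
  obtain KF KG where F: "KF-lipschitz_on UNIV (\<lambda>(x, u). F x u)"
    and G: "KG-lipschitz_on UNIV (\<lambda>(x, u). G x u)"
    using assms(1,2) unfolding globally_lipschitz_def by blast
  have sol: "master_equation_solution F G U" and graph: "graph_converges_at_0 U (point_operator x0)"
    using assms(3) by (auto simp: planning_solution_def)
  obtain X W where init: "X t1 = x1" "W t1 = U t1 x1"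
    and X: "\<And>t. t \<in> {0..t1} \<Longrightarrow> (X has_vector_derivative F (X t) (W t)) (at t within {0..t1})"
    and W: "\<And>t. t \<in> {0..t1} \<Longrightarrow> (W has_vector_derivative G (X t) (W t)) (at t within {0..t1})"
    using characteristic_system_backward_solution[OF F G] \<open>t1 > 0\<close> by (metis less_imp_le)
  have sub: "{0<..t1} \<subseteq> {0..t1}" by auto
  have X': "(X has_vector_derivative F (X t) (W t)) (at t within {0<..t1})"
    and W': "(W has_vector_derivative G (X t) (W t)) (at t within {0<..t1})" if "t \<in> {0<..t1}" for t
    using that by (auto intro!: has_vector_derivative_within_subset[OF X sub]
        has_vector_derivative_within_subset[OF W sub])
  have WU: "W t = U t (X t)" if "t \<in> {0<..t1}" for t
    using characteristics_carry_solution[OF F G sol X' W' _ that] init by simp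
  have traj: "backward_trajectory F U t1 x1 X"
    unfolding backward_trajectory_def using X' WU init by auto
  have lim: "(z \<longlongrightarrow> z 0) (at_right 0)"
    if "\<And>t. t \<in> {0..t1} \<Longrightarrow> (z has_vector_derivative z' t) (at t within {0..t1})"
    for z z' :: "real \<Rightarrow> real^'n"
  proof -
    have "continuous_on {0..t1} z" using that by (rule continuous_on_vector_derivative)
    hence "(z \<longlongrightarrow> z 0) (at 0 within {0..t1})"
      using \<open>t1 > 0\<close> by (simp add: continuous_on_def)
    thus ?thesis using \<open>t1 > 0\<close> by (simp add: at_within_Icc_at_right)
  qed
  \<comment> \<open>At time 0 only the characteristic pair \<open>(X, W)\<close> makes sense, not \<open>U\<close>: its value there is a
  limit of points on the graphs of \<open>U(t, \<cdot>)\<close>, and the limit graph lies over \<open>x0\<close> alone.\<close>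
  have "X 0 = x0"
  proof -
    define \<tau> where "\<tau> n = t1 * inverse (real (Suc n))" for n
    have "(\<lambda>n. t1 * inverse (real (Suc n))) \<longlonglongrightarrow> t1 * 0"
      by (intro tendsto_intros LIMSEQ_inverse_real_of_nat)
    hence \<tau>0: "\<tau> \<longlonglongrightarrow> 0" by (simp add: \<tau>_def[abs_def])
    have \<tau>: "\<tau> n \<in> {0<..t1}" for n
      using \<open>t1 > 0\<close> mult_left_mono[of "inverse (real (Suc n))" 1 t1]
      by (simp add: \<tau>_def inverse_le_1_iff)
    have \<tau>_right: "filterlim \<tau> (at_right 0) sequentially"
      using \<tau>0 \<tau> by (auto simp: filterlim_at less_le intro!: always_eventually)
    have "W 0 \<in> point_operator x0 (X 0)"
    proof -
      have conv: "graph_converges (\<lambda>n x. {U (\<tau> n) x}) (point_operator x0)"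
        using graph \<tau> \<tau>0 unfolding graph_converges_at_0_def by auto
      show ?thesis
      proof (rule conv[unfolded graph_converges_def, rule_format])
        show "W (\<tau> n) \<in> {U (\<tau> n) (X (\<tau> n))}" for n using WU \<tau> by simp
        show "(\<lambda>n. X (\<tau> n)) \<longlonglongrightarrow> X 0" by (rule filterlim_compose[OF lim[OF X] \<tau>_right])
        show "(\<lambda>n. W (\<tau> n)) \<longlonglongrightarrow> W 0" by (rule filterlim_compose[OF lim[OF W] \<tau>_right])
      qed
    qed
    thus ?thesis by (simp add: point_operator_def split: if_splits)
  qed
  moreover have "\<forall>y. backward_trajectory F U t1 x1 y \<longrightarrow> (\<forall>t\<in>{0<..t1}. y t = X t)"
    using backward_trajectory_unique[OF F _ traj] sol by (auto simp: master_equation_solution_def)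
  ultimately show ?thesis using traj lim[OF X] by auto
qed

end
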